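(* For every integer $k\ge 3$ and every real $\gamma>0$ the following holds for all sufficiently large integers $n$ divisible by $k$. Let $p$ be the smallest prime factor of $k$. If $H$ is a $k$-graph on $n$ vertices with $\alpha(H)\le n/p$ and $\delta_{k-1}(H)\ge (1/p+\gamma)n$, then $H$ contains a perfect matching.
   Context: A $k$-graph $H=(V(H),E(H))$ has edge set $E(H)\subseteq\binom{V(H)}{k}$. A perfect matching is a set of pairwise vertex-disjoint edges covering all vertices. For a $(k-1)$-set $S$ of vertices, $\deg_H(S)$ is the number of vertices $v$ with $S\cup\{v\}\in E(H)$; $\delta_{k-1}(H)$ is the minimum of $\deg_H(S)$ over all $(k-1)$-sets $S$. The independence number $\alpha(H)$ is the maximum size of a vertex set containing no edge of $H$. *)

theory Defs
  imports Complex_Main "HOL-Library.Ramsey" "HOL-Computational_Algebra.Primes"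
begin

definition uniform_hypergraph :: "nat \<Rightarrow> 'a set \<Rightarrow> 'a set set \<Rightarrow> bool" where
  "uniform_hypergraph k V E \<longleftrightarrow> finite V \<and> E \<subseteq> nsets V k"

definition hdegree :: "'a set \<Rightarrow> 'a set set \<Rightarrow> 'a set \<Rightarrow> nat" where
  "hdegree V E S = card {v \<in> V. insert v S \<in> E}"

text \<open>Meaningful when \<open>nsets V d\<close> is finite and nonempty, that is, for finite \<open>V\<close> with
  \<open>d \<le> card V\<close>; \<open>Min\<close> is unspecified otherwise.\<close>

definition min_hdegree :: "nat \<Rightarrow> 'a set \<Rightarrow> 'a set set \<Rightarrow> nat" where
  "min_hdegree d V E = Min (hdegree V E ` nsets V d)"

definition independent_set :: "'a set \<Rightarrow> 'a set set \<Rightarrow> 'a set \<Rightarrow> bool" where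
  "independent_set V E S \<longleftrightarrow> S \<subseteq> V \<and> (\<forall>e\<in>E. \<not> e \<subseteq> S)"

definition independence_number :: "'a set \<Rightarrow> 'a set set \<Rightarrow> nat" where
  "independence_number V E = Max (card ` {S. independent_set V E S})"

definition perfect_matching :: "'a set \<Rightarrow> 'a set set \<Rightarrow> 'a set set \<Rightarrow> bool" where
  "perfect_matching V E M \<longleftrightarrow> M \<subseteq> E \<and> pairwise disjnt M \<and> \<Union>M = V"

end

theory Submission
  imports Defs "HOL-Library.Multiset"
begin

text \<open>
  The proof uses absorption. Two vertices are reachable from each other if a positive proportion of
  bounded-size sets complete either of them to a tileable set. Since the links of any \<open>p\<close> vertices
  overlap substantially, the vertices split into fewer than \<open>p\<close> parts, all larger than
  \<open>n / p\<close>, inside which reachability holds uniformly. Whether a bounded set can be absorbed then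
  depends only on how many of its vertices lie in each part, that is, on a vector in the lattice
  spanned by the index vectors of dense edges. As every index vector of size \<open>k - 1\<close> extends to a
  dense one, the relevant quotient has exponent \<open>q < p\<close>, which is coprime to \<open>k\<close>. Each part
  exceeds the independence number and so contains an edge. Adding \<open>t\<close> such edges for each uncovered
  vertex, where \<open>1 + k t\<close> is divisible by \<open>q\<close>, moves every uncovered set into the lattice. An
  almost perfect matching comes from local switching, and an absorbing set from greedy averaging.
\<close>

section \<open>Tileable multisets and reachability\<close>

text \<open>The obstacle is divisibility: a leftover set whose index vector lies outside the lattice
  of dense edges has no guaranteed absorber. The bound on the independence number breaks this
  barrier, but it only says that every set of more than \<open>n / p\<close> vertices contains an
  edge, not that a positive proportion of its \<open>k\<close>-tuples are edges. Such edges
  therefore cannot be used inside absorbers. They are reserved beforehand, boundedly many in each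
  part, which is enough because the almost perfect matching misses fewer than
  \<open>k * (k - 1)\<close> vertices. Giving up \<open>t\<close> reserved edges of its own part for
  each missed vertex multiplies the index vector \<open>x\<close> of the leftover by exactly
  \<open>1 + k * t\<close>. A second difficulty is the order of quantifiers. The partition, the
  lattice and \<open>t\<close> depend on the hypergraph, while every constant must be fixed before
  it. This is resolved by \<open>r < p\<close> and \<open>t < p\<close>, and by the fact that
  bounded index vectors over \<open>p\<close> labels allow only finitely many lattices.\<close>

inductive tileable :: "'a set set \<Rightarrow> 'a multiset \<Rightarrow> bool" for E where
  tileable_empty: "tileable E {#}"
| tileable_edge_add: "e \<in> E \<Longrightarrow> tileable E Z \<Longrightarrow> tileable E (mset_set e + Z)"

lemma tileable_edge: "e \<in> E \<Longrightarrow> tileable E (mset_set e)"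
  using tileable_edge_add[OF _ tileable_empty, of e E] by simp

lemma tileable_add: "tileable E X \<Longrightarrow> tileable E Y \<Longrightarrow> tileable E (X + Y)"
  by (induction rule: tileable.induct) (auto simp: add.assoc intro: tileable.intros)

lemma tileable_sum:
  "(\<And>i. i \<in> I \<Longrightarrow> tileable E (f i)) \<Longrightarrow> tileable E (\<Sum>i\<in>I. f i)"
  by (induction I rule: infinite_finite_induct) (auto intro: tileable_empty tileable_add)

text \<open>A sum of edges equal to \<open>mset_set V\<close> covers each vertex exactly once, so
  its edges are automatically disjoint. This is where multisets turn back into sets.\<close>

lemma perfect_matching_if_tileable:
  assumes "tileable E (mset_set V)" "finite V" "\<And>e. e \<in> E \<Longrightarrow> finite e \<and> e \<noteq> {}"
  shows "\<exists>M. perfect_matching V E M"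
  using assms(1,2)
proof (induction "mset_set V" arbitrary: V rule: tileable.induct)
  case tileable_empty
  then have "V = {}" by (metis mset_set_empty_iff infinite_set_mset_mset_set finite_set_mset_mset_set set_mset_empty)
  then show ?case by (intro exI[of _ "{}"]) (auto simp: perfect_matching_def)
next
  case (tileable_edge_add e Z)
  have fe: "finite e" and ne: "e \<noteq> {}" using assms(3) tileable_edge_add by auto
  have sub: "e \<subseteq> V"
    using tileable_edge_add fe by (metis msubset_mset_set_iff mset_subset_eq_add_left)
  have "Z = mset_set (V - e)"
    using tileable_edge_add(4) mset_set_Diff[OF \<open>finite V\<close> sub] by (metis add_diff_cancel_left')
  then obtain M where M: "perfect_matching (V - e) E M"
    using tileable_edge_add by blast
  have "perfect_matching V E (insert e M)"
    using M tileable_edge_add(1) sub unfolding perfect_matching_def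
    by (auto simp: pairwise_insert disjnt_def)
  then show ?case by blast
qed

lemma size_tileable:
  assumes "tileable E Z" "\<And>e. e \<in> E \<Longrightarrow> card e = k"
  shows "k dvd size Z"
  using assms by (induction rule: tileable.induct) auto

section \<open>Exchange tuples and the calculus of reachability\<close>

definition vlists :: "'a set \<Rightarrow> nat \<Rightarrow> 'a list set" where
  "vlists V t = {xs. set xs \<subseteq> V \<and> length xs = t}"

lemma finite_vlists [simp]: "finite V \<Longrightarrow> finite (vlists V t)"
  unfolding vlists_def by (rule finite_lists_length_eq)

lemma card_vlists: "finite V \<Longrightarrow> card (vlists V t) = card V ^ t"
  unfolding vlists_def by (rule card_lists_length_eq)

text \<open>For \<open>Y = {#}\<close> these are the absorbers of \<open>X\<close>: tuples that are
  tileable both alone and together with \<open>X\<close>. Hence \<open>reach V E N X {#}\<close>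
  says that \<open>X\<close> has a positive proportion of absorbers.\<close>

definition exch :: "'a set \<Rightarrow> 'a set set \<Rightarrow> nat \<Rightarrow> 'a multiset \<Rightarrow> 'a multiset \<Rightarrow> 'a list set" where
  "exch V E t X Y = {T \<in> vlists V t. tileable E (mset T + X) \<and> tileable E (mset T + Y)}"

text \<open>Vertices are collected in multisets and tuples that may repeat or overlap. Then reachability
  composes without disjointness conditions; the few degenerate tuples are discarded only when the
  absorbing set is selected. A single \<open>N\<close> bounds both the length and the inverse density of the
  tuples, and \<open>t\<close> is not fixed, so \<open>reach\<close> is monotone in \<open>N\<close>.\<close>

definition reach :: "'a set \<Rightarrow> 'a set set \<Rightarrow> nat \<Rightarrow> 'a multiset \<Rightarrow> 'a multiset \<Rightarrow> bool" where
  "reach V E N X Y \<longleftrightarrow> (\<exists>t\<le>N. card V ^ t \<le> N * card (exch V E t X Y))"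

lemma finite_exch [simp]: "finite V \<Longrightarrow> finite (exch V E t X Y)"
  unfolding exch_def by simp

lemma reach_mono: "reach V E N X Y \<Longrightarrow> N \<le> N' \<Longrightarrow> reach V E N' X Y"
  unfolding reach_def by (meson le_trans mult_le_mono1)

lemma reach_sym: "reach V E N X Y \<Longrightarrow> reach V E N Y X"
  unfolding reach_def exch_def by (simp add: conj_commute)

lemma reach_tileable:
  assumes "tileable E X" "tileable E Y"
  shows "reach V E 1 X Y"
  unfolding reach_def
proof (intro exI[of _ 0] conjI)
  have "exch V E 0 X Y = {[]}"
    using assms by (auto simp: exch_def vlists_def)
  then show "card V ^ 0 \<le> 1 * card (exch V E 0 X Y)" by simp
qed simp

lemma card_image_append:
  assumes "finite A" "\<And>x. x \<in> A \<Longrightarrow> length x = s" "\<And>x. x \<in> A \<Longrightarrow> finite (B x)"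
  shows "card {x @ y | x y. x \<in> A \<and> y \<in> B x} = (\<Sum>x\<in>A. card (B x))"
proof -
  have "{x @ y | x y. x \<in> A \<and> y \<in> B x} = (\<lambda>(x, y). x @ y) ` Sigma A B" by auto
  moreover have "inj_on (\<lambda>(x, y). x @ y) (Sigma A B)"
    using assms(2) by (fastforce intro!: inj_onI)
  ultimately show ?thesis using assms by (simp add: card_image)
qed

text \<open>Tuples are concatenated. The shifted product bounds both the new length
  \<open>N + N'\<close> and the new inverse density \<open>N * N'\<close>.\<close>

lemma reach_add:
  assumes "finite V" "reach V E N X Y" "reach V E N' X' Y'"
  shows "reach V E ((N + 1) * (N' + 1)) (X + X') (Y + Y')"
proof -
  obtain t where t: "t \<le> N" "card V ^ t \<le> N * card (exch V E t X Y)"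
    using assms unfolding reach_def by blast
  obtain t' where t': "t' \<le> N'" "card V ^ t' \<le> N' * card (exch V E t' X' Y')"
    using assms unfolding reach_def by blast
  let ?S = "{x @ y | x y. x \<in> exch V E t X Y \<and> y \<in> exch V E t' X' Y'}"
  have "?S \<subseteq> exch V E (t + t') (X + X') (Y + Y')"
  proof
    fix z assume "z \<in> ?S"
    then obtain x y where z: "z = x @ y" "x \<in> exch V E t X Y" "y \<in> exch V E t' X' Y'" by blast
    then have "tileable E ((mset x + X) + (mset y + X'))" "tileable E ((mset x + Y) + (mset y + Y'))"
      by (auto simp: exch_def intro!: tileable_add)
    then show "z \<in> exch V E (t + t') (X + X') (Y + Y')"
      using z by (auto simp: exch_def vlists_def ac_simps)
  qed
  then have "card ?S \<le> card (exch V E (t + t') (X + X') (Y + Y'))"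
    using assms(1) by (intro card_mono) auto
  moreover have "card ?S = card (exch V E t X Y) * card (exch V E t' X' Y')"
  proof (subst card_image_append[of _ t])
    show "length x = t" if "x \<in> exch V E t X Y" for x
      using that by (simp add: exch_def vlists_def)
  qed (use assms(1) in simp_all)
  ultimately have le: "card (exch V E t X Y) * card (exch V E t' X' Y') \<le> card (exch V E (t + t') (X + X') (Y + Y'))"
    by simp
  have "card V ^ (t + t') \<le> (N * card (exch V E t X Y)) * (N' * card (exch V E t' X' Y'))"
    unfolding power_add using t t' by (intro mult_le_mono) auto
  also have "\<dots> = (N * N') * (card (exch V E t X Y) * card (exch V E t' X' Y'))" by simp
  also have "\<dots> \<le> ((N + 1) * (N' + 1)) * card (exch V E (t + t') (X + X') (Y + Y'))"
    using le by (intro mult_le_mono) auto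
  finally show ?thesis unfolding reach_def
    using t(1) t'(1) by (intro exI[of _ "t + t'"]) auto
qed

lemma pigeonhole_fraction:
  fixes N :: nat
  assumes "finite A" "\<And>x. x \<in> A \<Longrightarrow> f x \<le> N"
  shows "\<exists>t\<le>N. card A \<le> (N + 1) * card {x \<in> A. f x = t}"
proof (rule ccontr)
  assume "\<not> ?thesis"
  then have lt: "(N + 1) * card {x \<in> A. f x = t} < card A" if "t \<le> N" for t using that by force
  have "A = (\<Union>t\<in>{..N}. {x \<in> A. f x = t})" using assms(2) by auto
  then have "card A \<le> (\<Sum>t\<le>N. card {x \<in> A. f x = t})"
    by (metis card_UN_le finite_atMost)
  then have "(N + 1) * card A \<le> (\<Sum>t\<le>N. (N + 1) * card {x \<in> A. f x = t})"
    by (metis mult_le_mono2 sum_distrib_left)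
  also have "\<dots> < (\<Sum>t\<le>N. card A)" using lt by (intro sum_strict_mono) auto
  finally show False by simp
qed

text \<open>The summand \<open>w\<close> is moved into the tuple: if \<open>T\<close> exchanges
  \<open>X + mset w\<close> and \<open>Y + mset w\<close>, then \<open>w @ T\<close> exchanges
  \<open>X\<close> and \<open>Y\<close>. A positive proportion of the \<open>w\<close> is required
  to keep these tuples dense. The length of \<open>T\<close> may vary with \<open>w\<close>, so a
  most frequent length is fixed first.\<close>

lemma reach_cancel:
  assumes V: "finite V" and A: "A \<subseteq> vlists V s" "card V ^ s \<le> M * card A"
    and R: "\<And>w. w \<in> A \<Longrightarrow> reach V E N (X + mset w) (Y + mset w)"
  shows "reach V E (s + N + M * (N + 1) * N) X Y"
proof -
  have "\<forall>w\<in>A. \<exists>t\<le>N. card V ^ t \<le> N * card (exch V E t (X + mset w) (Y + mset w))"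
    using R unfolding reach_def by blast
  then obtain f where f: "\<And>w. w \<in> A \<Longrightarrow> f w \<le> N"
    "\<And>w. w \<in> A \<Longrightarrow> card V ^ f w \<le> N * card (exch V E (f w) (X + mset w) (Y + mset w))"
    by metis
  have finA: "finite A" using finite_subset[OF A(1)] V by simp
  obtain t where t: "t \<le> N" "card A \<le> (N + 1) * card {w \<in> A. f w = t}"
    using pigeonhole_fraction[of A f N] finA f(1) by blast
  define B where "B = {w \<in> A. f w = t}"
  let ?S = "{x @ y | x y. x \<in> B \<and> y \<in> exch V E t (X + mset x) (Y + mset x)}"
  have "?S \<subseteq> exch V E (s + t) X Y"
    using A(1) by (fastforce simp: B_def exch_def vlists_def ac_simps)
  then have 1: "card ?S \<le> card (exch V E (s + t) X Y)" using V by (intro card_mono) auto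
  have 2: "card ?S = (\<Sum>x\<in>B. card (exch V E t (X + mset x) (Y + mset x)))"
    using A(1) finA V by (intro card_image_append[of _ s]) (auto simp: B_def vlists_def)
  have "card B * card V ^ t \<le> (\<Sum>x\<in>B. N * card (exch V E t (X + mset x) (Y + mset x)))"
    using f(2) by (intro sum_bounded_below[of B "card V ^ t", simplified]) (auto simp: B_def)
  also have "\<dots> = N * card ?S" unfolding 2 by (simp add: sum_distrib_left)
  finally have 3: "card B * card V ^ t \<le> N * card (exch V E (s + t) X Y)"
    using 1 by (meson le_trans mult_le_mono2)
  have "card V ^ (s + t) \<le> M * ((N + 1) * card B) * card V ^ t"
    unfolding power_add using A(2) t(2) unfolding B_def
    by (intro mult_le_mono1) (meson le_trans mult_le_mono2)
  also have "\<dots> = M * (N + 1) * (card B * card V ^ t)" by (simp only: ac_simps)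
  also have "\<dots> \<le> M * (N + 1) * (N * card (exch V E (s + t) X Y))"
    using 3 by (rule mult_le_mono2)
  also have "\<dots> \<le> (s + N + M * (N + 1) * N) * card (exch V E (s + t) X Y)"
    by (simp add: algebra_simps)
  finally show ?thesis unfolding reach_def using t(1) by (intro exI[of _ "s + t"]) auto
qed

text \<open>Transitivity through a dense family of intermediate tuples: adding the two relations
  connects \<open>X + mset w\<close> with \<open>mset w + Y\<close>, and \<open>w\<close>
  cancels.\<close>

lemma reach_compose:
  assumes V: "finite V" and A: "A \<subseteq> vlists V s" "card V ^ s \<le> M * card A"
    and R: "\<And>w. w \<in> A \<Longrightarrow> reach V E N X (mset w)" "\<And>w. w \<in> A \<Longrightarrow> reach V E N' (mset w) Y"
  shows "reach V E (s + (N + 1) * (N' + 1) + M * ((N + 1) * (N' + 1) + 1) * ((N + 1) * (N' + 1))) X Y"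
  using V A
proof (rule reach_cancel)
  fix w assume "w \<in> A"
  then show "reach V E ((N + 1) * (N' + 1)) (X + mset w) (Y + mset w)"
    using reach_add[OF V R(1) R(2)] by (simp add: add.commute)
qed

section \<open>Partition into reachable parts\<close>

lemma antimono_stationary:
  fixes f :: "nat \<Rightarrow> nat"
  assumes "\<And>i. f (Suc i) \<le> f i" "f 0 < p"
  shows "\<exists>i\<le>2 * p. f (Suc (Suc i)) = f i"
proof (rule ccontr)
  assume "\<not> ?thesis"
  then have ne: "f (Suc (Suc i)) \<noteq> f i" if "i \<le> 2 * p" for i using that by blast
  have drop: "f (Suc (Suc i)) < f i" if "i \<le> 2 * p" for i
    using ne[OF that] assms(1)[of i] assms(1)[of "Suc i"] by linarith
  have "f (2 * j) + j \<le> f 0" if "j \<le> p" for j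
    using that
  proof (induction j)
    case (Suc j)
    then show ?case using drop[of "2 * j"] by simp
  qed simp
  from this[of p] show False using assms(2) by simp
qed

text \<open>The maximum size of an \<open>R i\<close>-independent set decreases with \<open>i\<close>, hence is the same at levels
  \<open>i\<close>, \<open>i + 1\<close>, \<open>i + 2\<close> for some \<open>i \<le> 2 p\<close>. The neighbourhoods of a maximum
  independent set \<open>A\<close> at level \<open>i + 2\<close> cover everything at level \<open>i\<close> and overlap little at
  level \<open>i + 1\<close>; two vertices lying in exactly one and the same neighbourhood are related, as
  otherwise they could replace its centre in \<open>A\<close>.\<close>

lemma dense_reachability_partition:
  fixes V :: "'a set" and R :: "nat \<Rightarrow> 'a \<Rightarrow> 'a \<Rightarrow> bool" and M p :: nat
  assumes V: "finite V" "V \<noteq> {}"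
    and refl: "\<And>i u. u \<in> V \<Longrightarrow> R i u u"
    and sym: "\<And>i u v. R i u v \<Longrightarrow> R i v u"
    and mono: "\<And>i u v. R i u v \<Longrightarrow> R (Suc i) u v"
    and step: "\<And>i u v. u \<in> V \<Longrightarrow> v \<in> V \<Longrightarrow>
                 card V \<le> M * card {w \<in> V. R i u w \<and> R i w v} \<Longrightarrow> R (Suc i) u v"
    and deg: "\<And>u. u \<in> V \<Longrightarrow> card V \<le> p * card {w \<in> V. R 0 u w}"
    and ind: "\<And>I. I \<subseteq> V \<Longrightarrow> card I = p \<Longrightarrow> \<exists>u\<in>I. \<exists>v\<in>I. u \<noteq> v \<and> R 0 u v"
    and M: "p\<^sup>2 * (p + 1) \<le> M"
  shows "\<exists>A lab. A \<subseteq> V \<and> card A < p \<and> (\<forall>u\<in>V. lab u \<in> A) \<and>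
           (\<forall>u\<in>V. \<forall>v\<in>V. lab u = lab v \<longrightarrow> R (2 * p + 3) u v) \<and>
           (\<forall>a\<in>A. M * card {w \<in> V. R 0 a w} \<le> M * card {u \<in> V. lab u = a} + p * card V)"
proof -
  have monoR: "R i u v \<Longrightarrow> i \<le> j \<Longrightarrow> R j u v" for i j u v
    by (induction j) (auto simp: le_Suc_eq intro: mono)
  define indep where "indep i I \<longleftrightarrow> I \<subseteq> V \<and> pairwise (\<lambda>u v. \<not> R i u v) I" for i I
  define \<alpha> where "\<alpha> i = Max (card ` {I. indep i I})" for i
  have finI: "finite {I. indep i I}" for i
    by (rule finite_subset[of _ "Pow V"]) (use V in \<open>auto simp: indep_def\<close>)
  have neI: "{} \<in> {I. indep i I}" for i by (simp add: indep_def)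
  have le_\<alpha>: "card I \<le> \<alpha> i" if "indep i I" for i I
    unfolding \<alpha>_def using that finI by (intro Max_ge) auto
  have \<alpha>_ex: "\<exists>I. indep i I \<and> card I = \<alpha> i" for i
  proof -
    have "\<alpha> i \<in> card ` {I. indep i I}"
      unfolding \<alpha>_def using finI neI by (intro Max_in) auto
    then show ?thesis by auto
  qed
  have indep_mono: "indep (Suc i) I \<Longrightarrow> indep i I" for i I
    unfolding indep_def pairwise_def using mono by blast
  have \<alpha>_anti: "\<alpha> (Suc i) \<le> \<alpha> i" for i
    using \<alpha>_ex[of "Suc i"] le_\<alpha> indep_mono by metis
  have "\<alpha> 0 < p"
  proof (rule ccontr)
    assume "\<not> \<alpha> 0 < p"
    then obtain I where I: "indep 0 I" "p \<le> card I" using \<alpha>_ex[of 0] by auto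
    then obtain J where "J \<subseteq> I" "card J = p" by (metis obtain_subset_with_card_n)
    then show False using I ind[of J] unfolding indep_def pairwise_def by blast
  qed
  then obtain i where i: "i \<le> 2 * p" "\<alpha> (Suc (Suc i)) = \<alpha> i"
    using antimono_stationary[of \<alpha> p] \<alpha>_anti by blast
  have \<alpha>1: "\<alpha> (Suc i) = \<alpha> i" using i \<alpha>_anti by (metis le_antisym)
  obtain A where A: "indep (Suc (Suc i)) A" "card A = \<alpha> i" using \<alpha>_ex i by metis
  have AV: "A \<subseteq> V" using A by (simp add: indep_def)
  have finA: "finite A" using AV V finite_subset by blast
  have cardA: "card A < p"
  proof -
    have "\<alpha> i \<le> \<alpha> 0" by (rule lift_Suc_antimono_le[of \<alpha>]) (use \<alpha>_anti in auto)
    then show ?thesis using A \<open>\<alpha> 0 < p\<close> by simp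
  qed
  define N where "N j u = {w \<in> V. R j u w}" for j u
  have finN: "finite (N j u)" for j u using V by (simp add: N_def)
  have sparse: "M * card (N (Suc i) a \<inter> N (Suc i) b) < card V" if "a \<in> A" "b \<in> A" "a \<noteq> b" for a b
  proof (rule ccontr)
    assume c: "\<not> ?thesis"
    have "N (Suc i) a \<inter> N (Suc i) b = {w \<in> V. R (Suc i) a w \<and> R (Suc i) w b}"
      using sym unfolding N_def by blast
    then have "R (Suc (Suc i)) a b" using c that AV by (intro step) auto
    then show False using A that by (auto simp: indep_def pairwise_def)
  qed
  have cover: "\<exists>a\<in>A. w \<in> N i a" if "w \<in> V" for w
  proof (rule ccontr)
    assume c: "\<not> ?thesis"
    then have nr: "\<not> R i a w" "\<not> R i w a" if "a \<in> A" for a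
      using that sym \<open>w \<in> V\<close> by (auto simp: N_def)
    then have "w \<notin> A" using refl that by blast
    have "indep i A" using A indep_mono by blast
    then have "indep i (insert w A)"
      using nr that unfolding indep_def by (auto simp: pairwise_insert)
    then show False using le_\<alpha>[of i "insert w A"] \<open>w \<notin> A\<close> finA A(2) by simp
  qed
  \<comment> \<open>\<open>N 0 u\<close> has density at least \<open>1 / p\<close> and is covered by
    fewer than \<open>p\<close> neighbourhoods, so one of them contains a proportion
    \<open>1 / p\<^sup>2\<close> of all vertices inside \<open>N 0 u\<close>. Its centre becomes the
    label of \<open>u\<close>.\<close>
  have "\<exists>a\<in>A. card V \<le> p\<^sup>2 * card (N 0 u \<inter> N i a)" if "u \<in> V" for u
  proof (rule ccontr)
    assume c: "\<not> ?thesis"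
    have "N 0 u \<subseteq> (\<Union>a\<in>A. N 0 u \<inter> N i a)" using cover by (auto simp: N_def)
    then have "card (N 0 u) \<le> (\<Sum>a\<in>A. card (N 0 u \<inter> N i a))"
      using finA finN by (intro order_trans[OF card_mono card_UN_le]) auto
    then have "p\<^sup>2 * card (N 0 u) \<le> (\<Sum>a\<in>A. p\<^sup>2 * card (N 0 u \<inter> N i a))"
      by (metis mult_le_mono2 sum_distrib_left)
    also have "\<dots> \<le> (\<Sum>a\<in>A. card V)" using c by (intro sum_mono) (meson nat_le_linear)
    also have "\<dots> = card A * card V" by simp
    also have "\<dots> < p * card V" using cardA V by (simp add: card_gt_0_iff)
    also have "\<dots> \<le> p * (p * card (N 0 u))" using deg[OF that] by (simp add: N_def)
    finally show False by (simp add: power2_eq_square)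
  qed
  then obtain lab where lab: "\<And>u. u \<in> V \<Longrightarrow> lab u \<in> A"
     "\<And>u. u \<in> V \<Longrightarrow> card V \<le> p\<^sup>2 * card (N 0 u \<inter> N i (lab u))" by metis
  have p2M: "p\<^sup>2 \<le> M" using M by (rule le_trans[rotated]) simp
  have N_mono: "N i a \<subseteq> N (Suc i) a" "N 0 a \<subseteq> N i a" for a
    using mono monoR[of 0 _ _ i] by (auto simp: N_def)
  \<comment> \<open>The atypical vertices of the neighbourhood of \<open>a\<close>, those shared
    with another centre at level \<open>i + 1\<close>.\<close>
  define X where "X a = (\<Union>b\<in>A - {a}. N (Suc i) a \<inter> N (Suc i) b)" for a
  have finX: "finite (X a)" for a using finA finN by (auto simp: X_def)
  have cardX: "M * card (X a) \<le> p * card V" if "a \<in> A" for a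
  proof -
    have "card (X a) \<le> (\<Sum>b\<in>A - {a}. card (N (Suc i) a \<inter> N (Suc i) b))"
      unfolding X_def using finA by (intro card_UN_le) simp
    then have "M * card (X a) \<le> (\<Sum>b\<in>A - {a}. M * card (N (Suc i) a \<inter> N (Suc i) b))"
      by (metis mult_le_mono2 sum_distrib_left)
    also have "\<dots> \<le> (\<Sum>b\<in>A - {a}. card V)" using sparse that by (intro sum_mono) (auto intro: less_imp_le)
    also have "\<dots> = card (A - {a}) * card V" by simp
    also have "\<dots> \<le> p * card V"
      using cardA card_Diff1_le[of A a] by (intro mult_le_mono1) linarith
    finally show ?thesis .
  qed
  have typical: "R (Suc i) x y" if "a \<in> A" "x \<in> N i a - X a" "y \<in> N i a - X a" for a x y
  proof (rule ccontr)
    assume c: "\<not> ?thesis"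
    have xy: "x \<in> V" "y \<in> V" "x \<noteq> y" "\<not> R (Suc i) y x" using that c refl sym by (auto simp: N_def)
    have out: "\<not> R (Suc i) b z \<and> \<not> R (Suc i) z b" if "b \<in> A - {a}" "z \<in> N i a - X a" for b z
    proof -
      have "z \<notin> N (Suc i) b" "z \<in> V" using that N_mono(1)[of a] by (auto simp: X_def N_def)
      then have "\<not> R (Suc i) b z" by (simp add: N_def)
      then show ?thesis using sym by blast
    qed
    have notin: "z \<notin> A - {a}" if "z \<in> N i a - X a" for z
      using out[OF _ that, of z] refl AV by blast
    have "indep (Suc i) A" using A indep_mono by blast
    then have "indep (Suc i) (A - {a})" by (auto simp: indep_def pairwise_def)
    then have "indep (Suc i) (insert x (insert y (A - {a})))"
      using xy c out that unfolding indep_def by (simp add: pairwise_insert) blast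
    moreover have "card (insert x (insert y (A - {a}))) = Suc (card A)"
    proof -
      have "card (insert x (insert y (A - {a}))) = Suc (Suc (card (A - {a})))"
        using notin that xy(3) finA by simp
      also have "Suc (card (A - {a})) = card A"
        using finA \<open>a \<in> A\<close> by (rule card_Suc_Diff1)
      finally show ?thesis .
    qed
    ultimately show False using le_\<alpha>[of "Suc i" "insert x (insert y (A - {a}))"] A(2) \<alpha>1 by simp
  qed
  \<comment> \<open>The bound on \<open>M\<close> is chosen for this: \<open>M\<close> times the
    shared neighbourhood is at least \<open>(p + 1) * card V\<close>, and removing
    \<open>X (lab u)\<close> costs at most \<open>p * card V\<close>.\<close>
  have big: "card V \<le> M * card (N 0 u \<inter> (N i (lab u) - X (lab u)))" if "u \<in> V" for u
  proof -
    let ?c = "card (N 0 u \<inter> N i (lab u))" and ?B = "N 0 u \<inter> (N i (lab u) - X (lab u))"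
    have "?c \<le> card (?B \<union> X (lab u))" using finN finX by (intro card_mono) auto
    also have "\<dots> \<le> card ?B + card (X (lab u))" by (rule card_Un_le)
    finally have "M * ?c \<le> M * card ?B + M * card (X (lab u))" by (metis distrib_left mult_le_mono2)
    also have "\<dots> \<le> M * card ?B + p * card V" using cardX lab that by simp
    finally have 1: "M * ?c \<le> M * card ?B + p * card V" .
    have "(p + 1) * card V \<le> (p + 1) * (p\<^sup>2 * ?c)" using lab that by (intro mult_le_mono2) auto
    also have "\<dots> = (p\<^sup>2 * (p + 1)) * ?c" by (simp only: ac_simps)
    also have "\<dots> \<le> M * ?c" using M by (rule mult_le_mono1)
    finally show ?thesis using 1 by simp
  qed
  \<comment> \<open>Two steps through the typical set of the common label: typical vertices are
    related at level \<open>i + 1\<close>, hence to \<open>v\<close> at level \<open>i + 2\<close>,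
    hence \<open>u\<close> to \<open>v\<close> at level \<open>i + 3\<close>.\<close>
  have close: "R (2 * p + 3) u v" if "u \<in> V" "v \<in> V" "lab u = lab v" for u v
  proof -
    let ?T = "N i (lab u) - X (lab u)"
    have xv: "R (Suc (Suc i)) x v" if x: "x \<in> ?T" for x
    proof (rule step)
      have "N 0 v \<inter> ?T \<subseteq> {w \<in> V. R (Suc i) x w \<and> R (Suc i) w v}"
        using typical[OF lab(1)[OF \<open>u \<in> V\<close>] x] sym monoR[of 0 _ _ "Suc i"] unfolding N_def by blast
      then have "card (N 0 v \<inter> ?T) \<le> card {w \<in> V. R (Suc i) x w \<and> R (Suc i) w v}"
        using V by (intro card_mono) auto
      then have "M * card (N 0 v \<inter> ?T) \<le> M * card {w \<in> V. R (Suc i) x w \<and> R (Suc i) w v}"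
        by (rule mult_le_mono2)
      then show "card V \<le> M * card {w \<in> V. R (Suc i) x w \<and> R (Suc i) w v}"
        using big[OF \<open>v \<in> V\<close>] unfolding \<open>lab u = lab v\<close> by (rule order_trans[rotated])
    qed (use x \<open>v \<in> V\<close> in \<open>auto simp: N_def\<close>)
    have "R (Suc (Suc (Suc i))) u v"
    proof (rule step)
      have "N 0 u \<inter> ?T \<subseteq> {w \<in> V. R (Suc (Suc i)) u w \<and> R (Suc (Suc i)) w v}"
        using xv monoR[of 0 _ _ "Suc (Suc i)"] unfolding N_def by blast
      then have "card (N 0 u \<inter> ?T) \<le> card {w \<in> V. R (Suc (Suc i)) u w \<and> R (Suc (Suc i)) w v}"
        using V by (intro card_mono) auto
      then have "M * card (N 0 u \<inter> ?T) \<le> M * card {w \<in> V. R (Suc (Suc i)) u w \<and> R (Suc (Suc i)) w v}"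
        by (rule mult_le_mono2)
      then show "card V \<le> M * card {w \<in> V. R (Suc (Suc i)) u w \<and> R (Suc (Suc i)) w v}"
        by (rule order_trans[OF big[OF \<open>u \<in> V\<close>]])
    qed (use that in auto)
    then show ?thesis by (rule monoR) (use i in simp)
  qed
  \<comment> \<open>A vertex of \<open>N 0 a\<close> is related at level \<open>i + 1\<close> both
    to \<open>a\<close> and to its own centre. If these differ it lies in \<open>X a\<close>, so
    only few vertices of \<open>N 0 a\<close> carry another label.\<close>
  have size: "M * card (N 0 a) \<le> M * card {u \<in> V. lab u = a} + p * card V" if "a \<in> A" for a
  proof -
    have "N 0 a \<subseteq> {u \<in> V. lab u = a} \<union> X a"
    proof
      fix x assume x: "x \<in> N 0 a"
      then have xV: "x \<in> V" by (simp add: N_def)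
      have "R (Suc i) x (lab x)"
      proof (rule step)
        have "N 0 x \<inter> N i (lab x) \<subseteq> {w \<in> V. R i x w \<and> R i w (lab x)}"
          using sym monoR[of 0 _ _ i] unfolding N_def by blast
        then have "card (N 0 x \<inter> N i (lab x)) \<le> card {w \<in> V. R i x w \<and> R i w (lab x)}"
          using V by (intro card_mono) auto
        then show "card V \<le> M * card {w \<in> V. R i x w \<and> R i w (lab x)}"
          using lab(2)[OF xV] p2M by (meson le_trans mult_le_mono)
      qed (use lab xV AV in auto)
      then have "x \<in> N (Suc i) (lab x)" using sym xV unfolding N_def by blast
      moreover have "x \<in> N (Suc i) a" using x N_mono by blast
      ultimately show "x \<in> {u \<in> V. lab u = a} \<union> X a" using xV lab by (auto simp: X_def)
    qed
    then have "card (N 0 a) \<le> card ({u \<in> V. lab u = a} \<union> X a)"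
      using V finX by (intro card_mono) auto
    also have "\<dots> \<le> card {u \<in> V. lab u = a} + card (X a)" by (rule card_Un_le)
    finally have "M * card (N 0 a) \<le> M * card {u \<in> V. lab u = a} + M * card (X a)"
      by (metis distrib_left mult_le_mono2)
    then show ?thesis using cardX[OF that] by simp
  qed
  show ?thesis
    using AV cardA lab(1) close size unfolding N_def
    by (intro exI[of _ A] exI[of _ lab]) auto
qed

section \<open>The lattice of index vectors\<close>

text \<open>\<open>good R x\<close> says that \<open>x\<close> is an integer combination of elements of \<open>R\<close>; the two
  rules mirror the two ways of building absorbers.\<close>

inductive good :: "'b multiset set \<Rightarrow> 'b multiset \<Rightarrow> bool" for R where
  good_empty: "good R {#}"
| good_extend: "good R x \<Longrightarrow> v \<in> R \<Longrightarrow> good R (x + v)"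
| good_cancel: "good R (x + v) \<Longrightarrow> v \<in> R \<Longrightarrow> good R x"

lemma good_base: "v \<in> R \<Longrightarrow> good R v"
  using good_extend[OF good_empty] by auto

lemma good_add:
  assumes "good R x" "good R y" shows "good R (x + y)"
  using assms(1)
proof (induction rule: good.induct)
  case (good_extend x v)
  then show ?case using good.good_extend[of R "x + y" v] by (simp add: ac_simps)
next
  case (good_cancel x v)
  then show ?case using good.good_cancel[of R "x + y" v] by (simp add: ac_simps)
qed (use assms in simp)

lemma good_diff:
  assumes "good R y" "good R (x + y)" shows "good R x"
  using assms
proof (induction arbitrary: x rule: good.induct)
  case (good_extend y v)
  then show ?case using good.good_cancel[of R "x + y" v] by (simp add: ac_simps)
next
  case (good_cancel y v)
  then show ?case using good.good_extend[of R "x + y" v] by (simp add: ac_simps)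
qed simp

lemma good_sum: "(\<And>i. i \<in> I \<Longrightarrow> good R (f i)) \<Longrightarrow> good R (\<Sum>i\<in>I. f i)"
  by (induction I rule: infinite_finite_induct) (auto intro: good_empty good_add)

lemma good_repeat: "good R x \<Longrightarrow> good R (repeat_mset m x)"
  by (induction m) (auto intro: good_empty good_add)

lemma sum_constant_mset: "(\<Sum>i\<in>I. c) = repeat_mset (card I) c"
  by (induction I rule: infinite_finite_induct) auto

text \<open>Let \<open>q\<close> be the number of distinct classes of singletons modulo \<open>R\<close>. For fixed \<open>i\<close>,
  matching each class \<open>j\<close> with the class completing \<open>{#j#} + (k - 3) {#0#} + {#i#}\<close> permutes the
  classes; adding up all these relations shows that \<open>q {#i#}\<close> does not depend on \<open>i\<close>.\<close>

lemma good_multiple: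
  fixes R :: "nat multiset set"
  assumes k: "k \<ge> 3" and r: "0 < r" "r < p"
    and coprime: "\<And>q. 0 < q \<Longrightarrow> q < p \<Longrightarrow> coprime q k"
    and ext: "\<And>w. size w = k - 1 \<Longrightarrow> set_mset w \<subseteq> {..<r} \<Longrightarrow> \<exists>j<r. good R (add_mset j w)"
  shows "\<exists>t<p. \<forall>x. set_mset x \<subseteq> {..<r} \<longrightarrow> k dvd size x \<longrightarrow> good R (repeat_mset (1 + k * t) x)"
proof -
  \<comment> \<open>Congruence modulo the lattice without subtraction. Reflexivity is not free,
    since it asks for some complement \<open>z\<close>; for single labels it comes from
    \<open>ext2\<close>.\<close>
  define eqv where "eqv x y \<longleftrightarrow> (\<exists>z. good R (x + z) \<and> good R (y + z))" for x y :: "nat multiset"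
  have eqv_subst: "good R (y + w)" if xy: "eqv x y" and xw: "good R (x + w)" for x y w
  proof -
    obtain z where z: "good R (x + z)" "good R (y + z)" using xy unfolding eqv_def by blast
    have "good R ((y + w) + (x + z))"
      using good_add[OF xw z(2)] by (simp add: ac_simps)
    then show ?thesis using good_diff z by blast
  qed
  have eqv_sym: "eqv x y \<Longrightarrow> eqv y x" for x y by (auto simp: eqv_def)
  have eqv_trans: "eqv x y \<Longrightarrow> eqv y z \<Longrightarrow> eqv x z" for x y z
    using eqv_subst unfolding eqv_def by blast
  \<comment> \<open>The filler of \<open>k - 3\<close> zeros brings the pair \<open>j\<close>,
    \<open>i\<close> to size \<open>k - 1\<close>; this is where \<open>k \<ge> 3\<close>
    enters.\<close>
  have ext2: "\<exists>m<r. good R ({#j#} + (replicate_mset (k - 3) 0 + {#i#}) + {#m#})" if "j < r" "i < r" for i j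
    using ext[of "{#j#} + (replicate_mset (k - 3) 0 + {#i#})"] k r(1) that
    by (auto simp: subset_iff split: if_splits)
  have eqv_refl: "eqv {#j#} {#j#}" if "j < r" for j
    using ext2[OF that that] unfolding eqv_def by (metis union_assoc)
  define cl where "cl j = (LEAST j'. eqv {#j'#} {#j#})" for j
  have cl_eqv: "eqv {#cl j#} {#j#}" if "j < r" for j
    unfolding cl_def using eqv_refl[OF that] by (rule LeastI)
  have cl_less: "cl j < r" if "j < r" for j
    unfolding cl_def using eqv_refl[OF that] that by (meson Least_le le_less_trans)
  have cl_cong: "cl i = cl j" if "eqv {#i#} {#j#}" for i j
    unfolding cl_def using that eqv_trans eqv_sym by (intro arg_cong[where f = Least]) blast
  define I where "I = cl ` {..<r}"
  have I_eq: "i = j" if ij: "i \<in> I" "j \<in> I" "eqv {#i#} {#j#}" for i j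
  proof -
    obtain a b where ab: "i = cl a" "j = cl b" "a < r" "b < r" using ij by (auto simp: I_def)
    then have "eqv {#a#} {#b#}" using that cl_eqv eqv_trans eqv_sym by metis
    then show ?thesis using ab cl_cong by simp
  qed
  have I_less: "i < r" if "i \<in> I" for i using that cl_less by (auto simp: I_def)
  have finI: "finite I" by (simp add: I_def)
  define q where "q = card I"
  have q: "0 < q" "q < p"
  proof -
    show "0 < q" unfolding q_def card_gt_0_iff using finI r(1) by (auto simp: I_def)
    have "q \<le> card {..<r}" unfolding q_def I_def by (rule card_image_le) simp
    then show "q < p" using r by simp
  qed
  define B where "B = (\<Sum>j\<in>I. {#j#})"
  define c where "c = replicate_mset (k - 3) (0::nat)"
  have sum_good: "good R (repeat_mset q {#i#} + (B + B + repeat_mset q c))" if i: "i < r" for i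
  proof -
    have "\<exists>m\<in>I. good R ({#j#} + (c + {#i#}) + {#m#})" if jI: "j \<in> I" for j
    proof -
      obtain m where m: "m < r" "good R ({#j#} + (c + {#i#}) + {#m#})"
        using ext2[OF I_less[OF jI] i] unfolding c_def by blast
      have "good R ({#cl m#} + ({#j#} + (c + {#i#})))"
        using m by (intro eqv_subst[OF eqv_sym[OF cl_eqv]]) (auto simp: ac_simps)
      then show ?thesis using m by (intro bexI[of _ "cl m"]) (auto simp: I_def ac_simps)
    qed
    then obtain f where f: "\<And>j. j \<in> I \<Longrightarrow> f j \<in> I"
      "\<And>j. j \<in> I \<Longrightarrow> good R ({#j#} + (c + {#i#}) + {#f j#})" by metis
    have "inj_on f I"
    proof (rule inj_onI)
      fix a b assume ab: "a \<in> I" "b \<in> I" "f a = f b"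
      then have "eqv {#a#} {#b#}"
        using f(2)[of a] f(2)[of b] unfolding eqv_def
        by (intro exI[of _ "c + {#i#} + {#f a#}"]) (simp add: ac_simps add_mset_commute)
      then show "a = b" using I_eq ab by blast
    qed
    then have "bij_betw f I I" using endo_inj_surj[of I f] f(1) finI by (auto simp: bij_betw_def)
    then have fB: "(\<Sum>j\<in>I. {#f j#}) = B"
      unfolding B_def by (rule sum.reindex_bij_betw)
    have "good R (\<Sum>j\<in>I. {#j#} + (c + {#i#}) + {#f j#})" using f by (intro good_sum) auto
    also have "(\<Sum>j\<in>I. {#j#} + (c + {#i#}) + {#f j#}) = B + repeat_mset q (c + {#i#}) + B"
      by (simp only: sum.distrib sum_constant_mset fB B_def q_def repeat_mset_distrib2)
    also have "\<dots> = repeat_mset q {#i#} + (B + B + repeat_mset q c)"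
      by (simp add: repeat_mset_distrib2 ac_simps)
    finally show ?thesis .
  qed
  have eqv0: "eqv (repeat_mset q {#i#}) (repeat_mset q {#0#})" if "i < r" for i
    using sum_good[OF that] sum_good[OF r(1)] unfolding eqv_def by blast
  \<comment> \<open>Completing \<open>k - 1\<close> zeros and repeating the relation
    \<open>q\<close> times allows \<open>q\<close> copies of \<open>j\<close> to be traded for
    \<open>q\<close> zeros. So \<open>q * k\<close> zeros are good, and by \<open>move\<close> so is
    \<open>q\<close> times any vector whose size is a multiple of \<open>k\<close>.\<close>
  obtain j where j: "j < r" "good R (add_mset j (replicate_mset (k - 1) 0))"
    using ext[of "replicate_mset (k - 1) 0"] r(1) k by auto
  have "good R (repeat_mset q {#j#} + repeat_mset q (replicate_mset (k - 1) 0))"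
    using good_repeat[OF j(2), of q] by simp
  then have "good R (repeat_mset q {#0#} + repeat_mset q (replicate_mset (k - 1) 0))"
    by (rule eqv_subst[OF eqv0[OF j(1)]])
  also have "repeat_mset q {#0#} + repeat_mset q (replicate_mset (k - 1) 0) = repeat_mset (q * k) {#0::nat#}"
    using k by (intro multiset_eqI) (auto simp: algebra_simps diff_mult_distrib2)
  finally have kq: "good R (repeat_mset (q * k) {#0#})" .
  have move: "good R (repeat_mset q x + w)"
    if "set_mset x \<subseteq> {..<r}" "good R (repeat_mset (q * size x) {#0#} + w)" for x w
    using that
  proof (induction x arbitrary: w)
    case (add i x)
    have "good R (repeat_mset q {#0#} + (repeat_mset (q * size x) {#0#} + w))"
    proof -
      have "repeat_mset (q * size (add_mset i x)) {#0#} =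
          repeat_mset q {#0::nat#} + repeat_mset (q * size x) {#0#}"
        by (intro multiset_eqI) (simp add: algebra_simps)
      then show ?thesis using add.prems(2) by (metis union_assoc)
    qed
    then have "good R (repeat_mset q {#i#} + (repeat_mset (q * size x) {#0#} + w))"
      using add.prems(1) by (elim eqv_subst[OF eqv_sym[OF eqv0], rotated]) simp
    then have "good R (repeat_mset (q * size x) {#0#} + (repeat_mset q {#i#} + w))"
      by (simp add: ac_simps)
    then have "good R (repeat_mset q x + (repeat_mset q {#i#} + w))"
      using add by auto
    then show ?case by (simp add: ac_simps)
  qed simp
  have good_q: "good R (repeat_mset q x)" if "set_mset x \<subseteq> {..<r}" "k dvd size x" for x
  proof -
    have "\<exists>m. size x = k * m" using that(2) by blast
    then obtain m where m: "size x = k * m" ..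
    have "good R (repeat_mset m (repeat_mset (q * k) {#0#}))" using kq by (rule good_repeat)
    also have "repeat_mset m (repeat_mset (q * k) {#0::nat#}) = repeat_mset (q * size x) {#0::nat#} + {#}"
      by (intro multiset_eqI) (simp add: m)
    finally show ?thesis using move[OF that(1), of "{#}"] by simp
  qed
  \<comment> \<open>Coprimality of \<open>q\<close> and \<open>k\<close> makes
    \<open>k * b + 1\<close> a multiple of \<open>q\<close> for some \<open>b\<close>. Reducing
    \<open>b\<close> modulo \<open>q\<close> preserves this and keeps the witness below
    \<open>p\<close>.\<close>
  obtain a b where "q * a = k * b + gcd q k" using bezout_nat[of q k] q by blast
  then have "q * a = k * b + 1" using coprime[OF q] by (simp add: coprime_iff_gcd_eq_1)
  then have "q dvd k * b + 1" by (metis dvd_triv_left)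
  moreover have "(1 + k * (b mod q)) mod q = (k * b + 1) mod q"
  proof -
    have "(k * (b mod q) + 1) mod q = (k * (b mod q) mod q + 1) mod q" by (rule mod_add_left_eq[symmetric])
    also have "\<dots> = (k * b mod q + 1) mod q" by (simp only: mod_mult_right_eq)
    also have "\<dots> = (k * b + 1) mod q" by (rule mod_add_left_eq)
    finally show ?thesis by (simp only: add.commute)
  qed
  ultimately have "q dvd 1 + k * (b mod q)" by (simp only: dvd_eq_mod_eq_0)
  then obtain s where s: "1 + k * (b mod q) = q * s" by (rule dvdE)
  show ?thesis
  proof (intro exI[of _ "b mod q"] conjI allI impI)
    show "b mod q < p" using q by (meson less_trans mod_less_divisor)
    fix x :: "nat multiset" assume "set_mset x \<subseteq> {..<r}" "k dvd size x"
    then have "good R (repeat_mset s (repeat_mset q x))" by (intro good_repeat good_q)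
    then show "good R (repeat_mset (1 + k * (b mod q)) x)" unfolding s by (simp add: mult.commute)
  qed
qed

section \<open>Absorbers from membership in the lattice\<close>

text \<open>Everything that the construction of absorbers uses about one hypergraph. As a single
  predicate it lets the bounds \<open>N'\<close> below be quantified before the vertex set, the
  edges and the labelling.\<close>

definition labelled ::
    "nat \<Rightarrow> nat \<Rightarrow> 'b multiset set \<Rightarrow> 'a set \<Rightarrow> 'a set set \<Rightarrow> ('a \<Rightarrow> 'b) \<Rightarrow> bool" where
  "labelled k N R V E lab \<longleftrightarrow> finite V \<and>
     (\<forall>u\<in>V. \<forall>v\<in>V. lab u = lab v \<longrightarrow> reach V E N {#u#} {#v#}) \<and>
     (\<forall>v\<in>R. card V ^ k \<le>
        N * card {w \<in> vlists V k. tileable E (mset w) \<and> image_mset lab (mset w) = v})"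

text \<open>Vertices with equal labels are matched and exchanged one at a time, so the bound depends
  only on their number.\<close>

lemma reach_if_same_labels:
  "\<exists>N'. \<forall>(V :: 'a set) E lab X Y. labelled k N R V E lab \<longrightarrow> set_mset X \<subseteq> V \<longrightarrow> set_mset Y \<subseteq> V \<longrightarrow>
      image_mset lab X = image_mset lab Y \<longrightarrow> size X = s \<longrightarrow> reach V E N' X Y"
proof (induction s)
  case 0
  show ?case
    by (rule exI[of _ 1]) (auto simp: reach_tileable tileable_empty simp del: One_nat_def)
next
  case (Suc s)
  then obtain N' where N': "\<And>(V :: 'a set) E lab X Y. labelled k N R V E lab \<Longrightarrow> set_mset X \<subseteq> V \<Longrightarrow>
      set_mset Y \<subseteq> V \<Longrightarrow> image_mset lab X = image_mset lab Y \<Longrightarrow> size X = s \<Longrightarrow> reach V E N' X Y"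
    by blast
  show ?case
  proof (intro exI[of _ "(N + 1) * (N' + 1)"] allI impI)
    fix V :: "'a set" and E lab X Y
    assume h: "labelled k N R V E lab" "set_mset X \<subseteq> V" "set_mset Y \<subseteq> V"
      "image_mset lab X = image_mset lab Y" "size X = Suc s"
    obtain a X' where X: "X = add_mset a X'" using h(5) by (metis size_eq_Suc_imp_eq_union)
    have "lab a \<in># image_mset lab Y" using h(4) X by (metis image_mset_add_mset union_single_eq_member)
    then obtain b where b: "b \<in># Y" "lab b = lab a" by auto
    then obtain Y' where Y: "Y = add_mset b Y'" by (metis multi_member_split)
    have "reach V E N {#a#} {#b#}"
      using h X Y b unfolding labelled_def by (metis insert_subset set_mset_add_mset_insert)
    moreover have "reach V E N' X' Y'"
      using h X Y b by (intro N'[OF h(1)]) auto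
    ultimately have "reach V E ((N + 1) * (N' + 1)) ({#a#} + X') ({#b#} + Y')"
      using h(1) by (intro reach_add) (auto simp: labelled_def)
    then show "reach V E ((N + 1) * (N' + 1)) X Y" using X Y by simp
  qed
qed

text \<open>Each rule of \<open>good\<close> has a counterpart. For an extension by
  \<open>v\<close>, the part of \<open>S\<close> labelled \<open>v\<close> reaches densely many
  tileable tuples with the same labels, and through them \<open>{#}\<close>. For a cancellation, a
  tileable tuple labelled \<open>v\<close> is added to \<open>S\<close>, the sum is absorbed, and
  the tuple cancels.\<close>

lemma absorbable_if_good:
  assumes "good R x"
  shows "\<exists>N'. \<forall>(V :: 'a set) E lab S. labelled k N R V E lab \<longrightarrow> set_mset S \<subseteq> V \<longrightarrow>
      image_mset lab S = x \<longrightarrow> reach V E N' S {#}"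
  using assms
proof (induction rule: good.induct)
  case good_empty
  show ?case
    by (rule exI[of _ 1]) (auto simp: reach_tileable tileable_empty simp del: One_nat_def)
next
  case (good_extend x v)
  then obtain N1 where N1: "\<And>(V :: 'a set) E lab S. labelled k N R V E lab \<Longrightarrow> set_mset S \<subseteq> V \<Longrightarrow>
      image_mset lab S = x \<Longrightarrow> reach V E N1 S {#}" by blast
  obtain N2 where N2: "\<And>(V :: 'a set) E lab X Y. labelled k N R V E lab \<Longrightarrow> set_mset X \<subseteq> V \<Longrightarrow>
      set_mset Y \<subseteq> V \<Longrightarrow> image_mset lab X = image_mset lab Y \<Longrightarrow> size X = size v \<Longrightarrow> reach V E N2 X Y"
    using reach_if_same_labels[of k N R "size v"] by blast
  define N3 where "N3 = k + (N2 + 1) * (1 + 1) + N * ((N2 + 1) * (1 + 1) + 1) * ((N2 + 1) * (1 + 1))"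
  show ?case
  proof (intro exI[of _ "(N1 + 1) * (N3 + 1)"] allI impI)
    fix V :: "'a set" and E lab S
    assume h: "labelled k N R V E lab" "set_mset S \<subseteq> V" "image_mset lab S = x + v"
    obtain S1 S2 where S: "S = S1 + S2" "image_mset lab S1 = x" "image_mset lab S2 = v"
      using h(3) by (metis image_mset_eq_plusD)
    have V: "finite V" using h(1) by (simp add: labelled_def)
    have 1: "reach V E N1 S1 {#}" using h S by (intro N1) auto
    have 2: "reach V E N3 S2 {#}" unfolding N3_def
    proof (rule reach_compose[OF V])
      let ?A = "{w \<in> vlists V k. tileable E (mset w) \<and> image_mset lab (mset w) = v}"
      show "?A \<subseteq> vlists V k" by blast
      show "card V ^ k \<le> N * card ?A" using h(1) good_extend by (auto simp: labelled_def)
      fix w assume w: "w \<in> ?A"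
      show "reach V E N2 S2 (mset w)"
        using w h S by (intro N2[OF h(1)]) (auto simp: vlists_def)
      show "reach V E 1 (mset w) {#}" using w by (simp add: reach_tileable tileable_empty del: One_nat_def)
    qed
    show "reach V E ((N1 + 1) * (N3 + 1)) S {#}"
      using reach_add[OF V 1 2] S by simp
  qed
next
  case (good_cancel x v)
  then obtain N1 where N1: "\<And>(V :: 'a set) E lab S. labelled k N R V E lab \<Longrightarrow> set_mset S \<subseteq> V \<Longrightarrow>
      image_mset lab S = x + v \<Longrightarrow> reach V E N1 S {#}" by blast
  define N2 where "N2 = (N1 + 1) * (1 + 1)"
  show ?case
  proof (intro exI[of _ "k + N2 + N * (N2 + 1) * N2"] allI impI)
    fix V :: "'a set" and E lab S
    assume h: "labelled k N R V E lab" "set_mset S \<subseteq> V" "image_mset lab S = x"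
    have V: "finite V" using h(1) by (simp add: labelled_def)
    let ?A = "{w \<in> vlists V k. tileable E (mset w) \<and> image_mset lab (mset w) = v}"
    show "reach V E (k + N2 + N * (N2 + 1) * N2) S {#}"
    proof (rule reach_cancel[OF V])
      show "?A \<subseteq> vlists V k" by blast
      show "card V ^ k \<le> N * card ?A" using h(1) good_cancel by (auto simp: labelled_def)
      fix w assume w: "w \<in> ?A"
      have "reach V E N1 (S + mset w) {#}"
        using w h by (intro N1[OF h(1)]) (auto simp: vlists_def)
      moreover have "reach V E 1 {#} (mset w)" using w by (simp add: reach_tileable tileable_empty del: One_nat_def)
      ultimately show "reach V E N2 (S + mset w) ({#} + mset w)"
        using reach_add[OF V, of E N1 "S + mset w" "{#}" 1 "{#}" "mset w"] by (simp add: N2_def)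
    qed
  qed
qed

lemma finite_multisets_bounded:
  assumes "finite A" shows "finite {x. set_mset x \<subseteq> A \<and> size x \<le> C}"
proof (rule finite_subset)
  show "{x. set_mset x \<subseteq> A \<and> size x \<le> C} \<subseteq> mset ` {xs. set xs \<subseteq> A \<and> length xs \<le> C}"
  proof
    fix x assume x: "x \<in> {x. set_mset x \<subseteq> A \<and> size x \<le> C}"
    obtain xs where "mset xs = x" using ex_mset by blast
    then show "x \<in> mset ` {xs. set xs \<subseteq> A \<and> length xs \<le> C}" using x by force
  qed
qed (use assms finite_lists_length_le in blast)

text \<open>The bound in \<open>absorbable_if_good\<close> depends on \<open>R\<close> and
  \<open>x\<close> through a derivation of unknown length. With finitely many labels and bounded
  sizes only finitely many pairs remain, and a maximum serves them all.\<close>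

lemma absorbable_uniform:
  fixes A :: "'b set"
  assumes "finite A"
  shows "\<exists>N'. \<forall>R V E lab S. R \<subseteq> {x. set_mset x \<subseteq> A \<and> size x \<le> k} \<longrightarrow>
      labelled k N R (V :: 'a set) E lab \<longrightarrow> set_mset S \<subseteq> V \<longrightarrow> lab ` V \<subseteq> A \<longrightarrow> size S \<le> C \<longrightarrow>
      good R (image_mset lab S) \<longrightarrow> reach V E N' S {#}"
proof -
  let ?RR = "Pow {x :: 'b multiset. set_mset x \<subseteq> A \<and> size x \<le> k}"
  let ?X = "{x :: 'b multiset. set_mset x \<subseteq> A \<and> size x \<le> C}"
  define Q where "Q R x N' \<longleftrightarrow> (\<forall>(V :: 'a set) E lab S. labelled k N R V E lab \<longrightarrow> set_mset S \<subseteq> V \<longrightarrow>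
      image_mset lab S = x \<longrightarrow> reach V E N' S {#})" for R and x :: "'b multiset" and N'
  have "\<forall>z. \<exists>N'. good (fst z) (snd z) \<longrightarrow> Q (fst z) (snd z) N'"
    unfolding Q_def using absorbable_if_good by blast
  then obtain f where f: "\<And>z. good (fst z) (snd z) \<Longrightarrow> Q (fst z) (snd z) (f z)" by metis
  have fin: "finite (?RR \<times> ?X)"
    using finite_multisets_bounded[OF assms] by simp
  show ?thesis
  proof (intro exI[of _ "Max (f ` (?RR \<times> ?X))"] allI impI)
    fix R and V :: "'a set" and E lab S
    assume h: "R \<subseteq> {x. set_mset x \<subseteq> A \<and> size x \<le> k}" "labelled k N R V E lab"
      "set_mset S \<subseteq> V" "lab ` V \<subseteq> A" "size S \<le> C" "good R (image_mset lab S)"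
    have "lab ` set_mset S \<subseteq> A" using h(3,4) by blast
    then have "(R, image_mset lab S) \<in> ?RR \<times> ?X" using h(1,5) by simp
    then have "f (R, image_mset lab S) \<le> Max (f ` (?RR \<times> ?X))"
      using fin by (intro Max_ge) auto
    moreover have "reach V E (f (R, image_mset lab S)) S {#}"
      using f[of "(R, image_mset lab S)"] h unfolding Q_def by simp
    ultimately show "reach V E (Max (f ` (?RR \<times> ?X))) S {#}" using reach_mono by blast
  qed
qed

section \<open>The absorbing set\<close>

text \<open>A list fails because its tail already fails or because its head lies in \<open>F\<close>
  or in the tail, which leaves at most \<open>card F + s\<close> choices for the head. The factor
  \<open>card V\<close> on the left avoids the exponent \<open>s - 1\<close>.\<close>

lemma card_bad_lists:
  assumes V: "finite V" and F: "finite F"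
  shows "card V * card {T \<in> vlists V s. \<not> (distinct T \<and> set T \<inter> F = {})} \<le> s * (s + card F) * card V ^ s"
proof (induction s)
  case 0
  have "{T \<in> vlists V 0. \<not> (distinct T \<and> set T \<inter> F = {})} = {}" by (auto simp: vlists_def)
  then show ?case by (simp only: card.empty mult_0_right mult_0 le_refl)
next
  case (Suc s)
  let ?B = "\<lambda>s. {T \<in> vlists V s. \<not> (distinct T \<and> set T \<inter> F = {})}"
  let ?n = "card V"
  let ?X = "(\<lambda>(x, T). x # T) ` (V \<times> ?B s)"
  let ?Y = "(\<lambda>(T, x). x # T) ` (SIGMA T:vlists V s. F \<union> set T)"
  have "?B (Suc s) \<subseteq> ?X \<union> ?Y"
  proof
    fix L assume L: "L \<in> ?B (Suc s)"
    then obtain x T where xT: "L = x # T" "x \<in> V" "T \<in> vlists V s"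
      by (auto simp: vlists_def length_Suc_conv)
    show "L \<in> ?X \<union> ?Y"
    proof (cases "x \<in> F \<union> set T")
      case True
      then have "(T, x) \<in> (SIGMA T:vlists V s. F \<union> set T)" using xT by blast
      then show ?thesis using xT(1) by force
    next
      case False
      then have "(x, T) \<in> V \<times> ?B s" using xT L by auto
      then show ?thesis using xT(1) by force
    qed
  qed
  then have "card (?B (Suc s)) \<le> card (?X \<union> ?Y)"
    using V F by (intro card_mono) auto
  also have "\<dots> \<le> card ?X + card ?Y" by (rule card_Un_le)
  also have "card ?X \<le> ?n * card (?B s)"
    using card_image_le[of "V \<times> ?B s" "\<lambda>(x, T). x # T"] V by (simp add: card_cartesian_product)
  also have "card ?Y \<le> (\<Sum>T\<in>vlists V s. card (F \<union> set T))"
    using card_image_le[of "SIGMA T:vlists V s. F \<union> set T" "\<lambda>(T, x). x # T"] V F by simp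
  also have "(\<Sum>T\<in>vlists V s. card (F \<union> set T)) \<le> (\<Sum>T\<in>vlists V s. card F + s)"
  proof (rule sum_mono)
    fix T assume "T \<in> vlists V s"
    then have "card (set T) \<le> s" using card_length[of T] by (simp add: vlists_def)
    then show "card (F \<union> set T) \<le> card F + s" using card_Un_le[of F "set T"] by linarith
  qed
  also have "\<dots> = ?n ^ s * (card F + s)" by (simp add: card_vlists[OF V])
  finally have "card (?B (Suc s)) \<le> ?n * card (?B s) + ?n ^ s * (card F + s)" by simp
  then have "?n * card (?B (Suc s)) \<le> ?n * (?n * card (?B s) + ?n ^ s * (card F + s))"
    by (rule mult_le_mono2)
  also have "\<dots> \<le> ?n * (s * (s + card F) * ?n ^ s + ?n ^ s * (card F + s))"
    using Suc.IH by (intro mult_le_mono2 add_le_mono) auto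
  also have "\<dots> = (s + 1) * (s + card F) * ?n ^ Suc s" by (simp add: algebra_simps)
  also have "\<dots> \<le> Suc s * (Suc s + card F) * ?n ^ Suc s" by (intro mult_le_mono1 mult_le_mono) auto
  finally show ?case .
qed

text \<open>Double counting of pairs of a set \<open>D\<close> and an absorber of it yields one
  tuple that serves a fixed proportion of the family. In the constant, \<open>N + 1\<close> pays for
  fixing one tuple length, \<open>N\<close> is the inverse density of absorbers, and 2 pays for
  discarding degenerate tuples.\<close>

lemma absorber_step:
  fixes V W :: "'a set" and \<D> :: "'a set set"
  assumes V: "finite V" and W: "finite W" and \<D>: "finite \<D>" "\<D> \<noteq> {}"
    and D: "\<And>D. D \<in> \<D> \<Longrightarrow> finite D \<and> card D \<le> C \<and> reach V E N (mset_set D) {#}"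
    and large: "2 * N * N * (N + card W + C) \<le> card V" and N: "0 < N"
  shows "\<exists>T. distinct T \<and> set T \<subseteq> V - W \<and> length T \<le> N \<and> tileable E (mset T) \<and>
     card \<D> \<le> 2 * N * (N + 1) * card {D \<in> \<D>. set T \<inter> D = {} \<and> tileable E (mset T + mset_set D)}"
proof -
  let ?n = "card V"
  have n: "0 < ?n" using large N by (cases "?n = 0") auto
  have "\<forall>D\<in>\<D>. \<exists>t\<le>N. ?n ^ t \<le> N * card (exch V E t (mset_set D) {#})"
    using D unfolding reach_def by blast
  then obtain f where f: "\<And>D. D \<in> \<D> \<Longrightarrow> f D \<le> N"
    "\<And>D. D \<in> \<D> \<Longrightarrow> ?n ^ f D \<le> N * card (exch V E (f D) (mset_set D) {#})" by metis
  obtain t where t: "t \<le> N" "card \<D> \<le> (N + 1) * card {D \<in> \<D>. f D = t}"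
    using pigeonhole_fraction[of \<D> f N] \<D>(1) f(1) by blast
  define \<D>' where "\<D>' = {D \<in> \<D>. f D = t}"
  have \<D>': "finite \<D>'" "\<D>' \<subseteq> \<D>" "card \<D> \<le> (N + 1) * card \<D>'" using \<D> t by (auto simp: \<D>'_def)
  define U where "U D = {T \<in> exch V E t (mset_set D) {#}. distinct T \<and> set T \<inter> (W \<union> D) = {}}" for D
  have finU: "finite (U D)" for D using V by (simp add: U_def)
  \<comment> \<open>By \<open>large\<close>, tuples that repeat a vertex or meet \<open>W\<close> or
    \<open>D\<close> amount to at most half of the guaranteed absorbers.\<close>
  have U_big: "?n ^ t \<le> 2 * N * card (U D)" if "D \<in> \<D>'" for D
  proof -
    let ?B = "{T \<in> vlists V t. \<not> (distinct T \<and> set T \<inter> (W \<union> D) = {})}"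
    have D': "finite D" "card D \<le> C" using D that \<D>' by auto
    have "card (W \<union> D) \<le> card W + C" using card_Un_le[of W D] D' by linarith
    then have "t * (t + card (W \<union> D)) \<le> N * (N + card W + C)" using t by (intro mult_le_mono) auto
    then have "?n * card ?B \<le> N * (N + card W + C) * ?n ^ t"
      using card_bad_lists[of V "W \<union> D" t] V W D' by (meson finite_UnI le_trans mult_le_mono1)
    then have "2 * N * (?n * card ?B) \<le> 2 * N * (N * (N + card W + C) * ?n ^ t)" by (rule mult_le_mono2)
    also have "\<dots> = (2 * N * N * (N + card W + C)) * ?n ^ t" by (simp only: ac_simps)
    also have "\<dots> \<le> ?n * ?n ^ t" using large by (rule mult_le_mono1)
    finally have "?n * (2 * N * card ?B) \<le> ?n * ?n ^ t" by (simp only: ac_simps)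
    then have B: "2 * N * card ?B \<le> ?n ^ t" using n by simp
    have "exch V E t (mset_set D) {#} \<subseteq> U D \<union> ?B" by (auto simp: U_def exch_def)
    then have "card (exch V E t (mset_set D) {#}) \<le> card (U D \<union> ?B)"
      using V finU by (intro card_mono) auto
    also have "\<dots> \<le> card (U D) + card ?B" by (rule card_Un_le)
    finally have "2 * N * card (exch V E t (mset_set D) {#}) \<le> 2 * N * (card (U D) + card ?B)"
      by (rule mult_le_mono2)
    then have "2 * N * card (exch V E t (mset_set D) {#}) \<le> 2 * N * card (U D) + 2 * N * card ?B"
      by (simp only: distrib_left)
    moreover have "2 * ?n ^ t \<le> 2 * N * card (exch V E t (mset_set D) {#})"
      using f(2)[of D] that by (auto simp: \<D>'_def)
    ultimately show ?thesis using B by linarith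
  qed
  have double: "(\<Sum>D\<in>\<D>'. card (U D)) = (\<Sum>T\<in>vlists V t. card {D \<in> \<D>'. T \<in> U D})"
  proof -
    have "U D = {T \<in> vlists V t. T \<in> U D}" for D by (auto simp: U_def exch_def)
    then have "(\<Sum>D\<in>\<D>'. card (U D)) = (\<Sum>D\<in>\<D>'. card {T \<in> vlists V t. T \<in> U D})" by simp
    also have "\<dots> = (\<Sum>T\<in>vlists V t. card {D \<in> \<D>'. T \<in> U D})"
      using V \<D>' by (intro sum_multicount_gen) auto
    finally show ?thesis .
  qed
  have "\<exists>T\<in>vlists V t. card \<D>' \<le> 2 * N * card {D \<in> \<D>'. T \<in> U D}"
  proof (rule ccontr)
    assume c: "\<not> ?thesis"
    have ne: "vlists V t \<noteq> {}"
      using card_vlists[OF V, of t] n by auto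
    have "?n ^ t * card \<D>' \<le> (\<Sum>D\<in>\<D>'. 2 * N * card (U D))"
      using U_big sum_bounded_below[of \<D>' "?n ^ t" "\<lambda>D. 2 * N * card (U D)"] by (simp add: mult.commute)
    also have "\<dots> = 2 * N * (\<Sum>T\<in>vlists V t. card {D \<in> \<D>'. T \<in> U D})"
      unfolding double[symmetric] by (rule sum_distrib_left[symmetric])
    also have "\<dots> = (\<Sum>T\<in>vlists V t. 2 * N * card {D \<in> \<D>'. T \<in> U D})"
      by (rule sum_distrib_left)
    also have "\<dots> < (\<Sum>T\<in>vlists V t. card \<D>')"
      using c ne V by (intro sum_strict_mono) auto
    also have "\<dots> = ?n ^ t * card \<D>'" by (simp add: card_vlists[OF V])
    finally show False by simp
  qed
  then obtain T where T: "T \<in> vlists V t" "card \<D>' \<le> 2 * N * card {D \<in> \<D>'. T \<in> U D}" by blast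
  let ?S = "{D \<in> \<D>. set T \<inter> D = {} \<and> tileable E (mset T + mset_set D)}"
  have "{D \<in> \<D>'. T \<in> U D} \<subseteq> ?S" using \<D>'(2) by (auto simp: U_def exch_def)
  then have "card {D \<in> \<D>'. T \<in> U D} \<le> card ?S" using \<D>(1) by (intro card_mono) auto
  then have *: "card \<D>' \<le> 2 * N * card ?S" using T(2) by (meson le_trans mult_le_mono2)
  have "(N + 1) * card \<D>' \<le> (N + 1) * (2 * N * card ?S)" using * by (rule mult_le_mono2)
  then have 1: "card \<D> \<le> 2 * N * (N + 1) * card ?S"
    using \<D>'(3) by (simp add: algebra_simps)
  \<comment> \<open>A positive count places \<open>T\<close> in some \<open>U D0\<close>, and this
    is what makes \<open>T\<close> distinct, disjoint from \<open>W\<close> and tileable by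
    itself.\<close>
  have "0 < card \<D>" using \<D> by (simp add: card_gt_0_iff)
  then have "0 < card \<D>'" using \<D>'(3) by (cases "card \<D>' = 0") auto
  then have "0 < card {D \<in> \<D>'. T \<in> U D}" using T(2) by (cases "card {D \<in> \<D>'. T \<in> U D} = 0") auto
  then obtain D0 where "T \<in> U D0" by (auto simp: card_gt_0_iff)
  then have "distinct T" "set T \<subseteq> V - W" "length T \<le> N" "tileable E (mset T)"
    using t by (auto simp: U_def exch_def vlists_def)
  then show ?thesis using 1 by blast
qed

text \<open>Iterates \<open>absorber_step\<close>; \<open>\<D>'\<close> holds the sets not yet
  served. A set once served stays served, because later tuples are tileable on their own, unless a
  later tuple meets it, which the premise \<open>W \<inter> D = {}\<close> excludes.\<close>

lemma absorber_family:
  fixes V :: "'a set" and \<D> :: "'a set set"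
  assumes V: "finite V" and \<D>: "finite \<D>"
    and D: "\<forall>D\<in>\<D>. finite D \<and> card D \<le> C \<and> reach V E N (mset_set D) {#}"
    and large: "2 * N * N * (N + m * N + C) \<le> card V" and N: "0 < N"
  shows "\<exists>W \<D>'. W \<subseteq> V \<and> card W \<le> m * N \<and> tileable E (mset_set W) \<and> \<D>' \<subseteq> \<D> \<and>
     (\<forall>D\<in>\<D> - \<D>'. W \<inter> D = {} \<longrightarrow> tileable E (mset_set (W \<union> D))) \<and>
     real (card \<D>') \<le> (1 - 1 / (2 * real N * (real N + 1))) ^ m * real (card \<D>)"
  using large
proof (induction m)
  case 0
  show ?case by (intro exI[of _ "{}"] exI[of _ \<D>]) (auto intro: tileable_empty)
next
  case (Suc m)
  let ?d = "1 - 1 / (2 * real N * (real N + 1))"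
  have "2 * real N * (real N + 1) \<ge> 1"
  proof -
    have "1 * 1 \<le> (2 * real N) * (real N + 1)" using N by (intro mult_mono) auto
    then show ?thesis by simp
  qed
  then have d0: "0 \<le> ?d" by simp
  have "2 * N * N * (N + m * N + C) \<le> 2 * N * N * (N + Suc m * N + C)" by (intro mult_le_mono2) simp
  then have "2 * N * N * (N + m * N + C) \<le> card V" using Suc.prems by linarith
  from Suc.IH[OF this] obtain W \<D>' where IH: "W \<subseteq> V" "card W \<le> m * N"
     "tileable E (mset_set W)" "\<D>' \<subseteq> \<D>"
     "\<forall>D\<in>\<D> - \<D>'. W \<inter> D = {} \<longrightarrow> tileable E (mset_set (W \<union> D))"
     "real (card \<D>') \<le> ?d ^ m * real (card \<D>)" by (elim exE conjE)
  have finW: "finite W" using IH V finite_subset by blast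
  have fin': "finite \<D>'" using IH \<D> finite_subset by blast
  show ?case
  proof (cases "\<D>' = {}")
    case True
    have "0 \<le> ?d ^ Suc m * real (card \<D>)" using d0 by simp
    then show ?thesis using IH True by (intro exI[of _ W] exI[of _ \<D>']) auto
  next
    case False
    have "2 * N * N * (N + card W + C) \<le> 2 * N * N * (N + Suc m * N + C)"
      using IH(2) by (intro mult_le_mono2) simp
    then have "2 * N * N * (N + card W + C) \<le> card V" using Suc.prems by linarith
    moreover have "finite D \<and> card D \<le> C \<and> reach V E N (mset_set D) {#}" if "D \<in> \<D>'" for D
      using D that IH(4) by blast
    ultimately obtain T where T: "distinct T" "set T \<subseteq> V - W" "length T \<le> N" "tileable E (mset T)"
      "card \<D>' \<le> 2 * N * (N + 1) * card {D \<in> \<D>'. set T \<inter> D = {} \<and> tileable E (mset T + mset_set D)}"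
      using absorber_step[OF V finW fin' False _ _ N, of C E] by blast
    define \<S> where "\<S> = {D \<in> \<D>'. set T \<inter> D = {} \<and> tileable E (mset T + mset_set D)}"
    have S: "\<S> \<subseteq> \<D>'" by (auto simp: \<S>_def)
    have mT: "mset_set (set T) = mset T" using T(1) by (simp add: mset_set_set)
    have WT: "mset_set (W \<union> set T) = mset_set W + mset T"
      using T finW by (subst mset_set_Union) (auto simp: mT)
    have cov: "tileable E (mset_set ((W \<union> set T) \<union> D))"
      if DD: "D \<in> \<D> - (\<D>' - \<S>)" "(W \<union> set T) \<inter> D = {}" for D
    proof -
      have finD: "finite D" using D DD by auto
      have dis: "W \<inter> D = {}" "set T \<inter> D = {}" using DD by auto
      have eq: "mset_set ((W \<union> set T) \<union> D) = mset_set W + mset T + mset_set D"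
        using finW finD DD(2) by (subst mset_set_Union) (auto simp: WT)
      show ?thesis
      proof (cases "D \<in> \<S>")
        case True
        then show ?thesis unfolding eq add.assoc using IH(3) by (auto simp: \<S>_def intro: tileable_add)
      next
        case False
        then have "tileable E (mset_set (W \<union> D))" using IH(5) DD dis by blast
        then have "tileable E (mset_set (W \<union> D) + mset T)" using T(4) by (rule tileable_add)
        also have "mset_set (W \<union> D) = mset_set W + mset_set D"
          using finW finD dis by (subst mset_set_Union) auto
        finally show ?thesis unfolding eq by (simp add: ac_simps)
      qed
    qed
    have "real (card (\<D>' - \<S>)) = real (card \<D>') - real (card \<S>)"
      using S fin' by (subst card_Diff_subset) (auto intro: finite_subset simp: of_nat_diff card_mono)
    also have "\<dots> \<le> ?d * real (card \<D>')"
    proof -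
      have "real (card \<D>') \<le> real (2 * N * (N + 1) * card \<S>)"
        using T(5) unfolding \<S>_def of_nat_le_iff .
      then have "real (card \<D>') \<le> (2 * real N * (real N + 1)) * real (card \<S>)"
        by (simp add: algebra_simps)
      moreover have pos: "0 < 2 * real N * (real N + 1)" using N by simp
      ultimately have "real (card \<D>') / (2 * real N * (real N + 1)) \<le> real (card \<S>)"
        by (subst pos_divide_le_eq[OF pos]) (simp add: algebra_simps)
      then show ?thesis by (simp add: left_diff_distrib)
    qed
    also have "\<dots> \<le> ?d * (?d ^ m * real (card \<D>))" using IH(6) d0 by (rule mult_left_mono)
    finally have card: "real (card (\<D>' - \<S>)) \<le> ?d ^ Suc m * real (card \<D>)" by simp
    have "card (W \<union> set T) \<le> Suc m * N"
      using card_Un_le[of W "set T"] card_length[of T] T(3) IH(2) by simp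
    moreover have "tileable E (mset_set (W \<union> set T))" unfolding WT using IH T by (blast intro: tileable_add)
    ultimately show ?thesis using IH T card cov
      by (intro exI[of _ "W \<union> set T"] exI[of _ "\<D>' - \<S>"]) auto
  qed
qed

lemma exponential_beats_polynomial:
  fixes a :: real
  assumes "0 < a" "a < 1"
  shows "(\<lambda>m::nat. a ^ m * (real m + 1) ^ C) \<longlonglongrightarrow> 0"
proof -
  define c where "c = - ln a"
  have c: "0 < c" using assms by (simp add: c_def)
  have "filterlim (\<lambda>m. c * real (Suc m)) at_top sequentially"
    by (rule filterlim_tendsto_pos_mult_at_top[OF tendsto_const c
          filterlim_compose[OF filterlim_real_sequentially filterlim_Suc]])
  then have "filterlim (\<lambda>m. c * (real m + 1)) at_top sequentially"
    by (simp only: of_nat_Suc add.commute)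
  then have "(\<lambda>m. (c * (real m + 1)) ^ C / exp (c * (real m + 1))) \<longlonglongrightarrow> 0"
    by (rule filterlim_compose[OF tendsto_power_div_exp_0])
  then have "(\<lambda>m. exp c / c ^ C * ((c * (real m + 1)) ^ C / exp (c * (real m + 1)))) \<longlonglongrightarrow> exp c / c ^ C * 0"
    by (intro tendsto_mult tendsto_const)
  moreover have "exp c / c ^ C * ((c * (real m + 1)) ^ C / exp (c * (real m + 1))) = a ^ m * (real m + 1) ^ C" for m
  proof -
    have "exp c / exp (c * (real m + 1)) = exp (- (c * real m))"
      by (simp add: exp_diff[symmetric] algebra_simps)
    also have "\<dots> = a ^ m"
      using assms by (simp add: c_def exp_of_nat_mult[symmetric] mult.commute)
        (metis exp_ln exp_of_nat_mult mult.commute)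
    finally have "exp c / exp (c * (real m + 1)) = a ^ m" .
    moreover have "(c * (real m + 1)) ^ C / c ^ C = (real m + 1) ^ C"
      unfolding power_mult_distrib using c by simp
    ultimately show ?thesis by (metis mult.commute times_divide_times_eq)
  qed
  ultimately show ?thesis by simp
qed

lemma card_small_subsets:
  assumes "finite V" "V \<noteq> {}"
  shows "card {D. D \<subseteq> V \<and> card D \<le> C} \<le> (C + 1) * card V ^ C"
proof -
  have n: "1 \<le> card V" using assms by (simp add: Suc_le_eq card_gt_0_iff)
  have fin: "finite {xs. set xs \<subseteq> V \<and> length xs \<le> C}"
    using assms(1) by (rule finite_lists_length_le)
  have "{D. D \<subseteq> V \<and> card D \<le> C} \<subseteq> set ` {xs. set xs \<subseteq> V \<and> length xs \<le> C}"
  proof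
    fix D assume D: "D \<in> {D. D \<subseteq> V \<and> card D \<le> C}"
    then have "finite D" using assms finite_subset by blast
    then obtain xs where "set xs = D" "distinct xs" using finite_distinct_list by blast
    then show "D \<in> set ` {xs. set xs \<subseteq> V \<and> length xs \<le> C}"
      using D distinct_card[of xs] by auto
  qed
  then have "card {D. D \<subseteq> V \<and> card D \<le> C} \<le> card (set ` {xs. set xs \<subseteq> V \<and> length xs \<le> C})"
    by (rule card_mono[OF finite_imageI[OF fin]])
  also have "\<dots> \<le> card {xs. set xs \<subseteq> V \<and> length xs \<le> C}"
    by (rule card_image_le[OF fin])
  also have "\<dots> = (\<Sum>i\<le>C. card V ^ i)" using assms by (simp add: card_lists_length_le)
  also have "\<dots> \<le> (\<Sum>i\<le>C. card V ^ C)" using n by (intro sum_mono power_increasing) auto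
  also have "\<dots> = (C + 1) * card V ^ C" by simp
  finally show ?thesis .
qed

text \<open>A number \<open>m\<close> of rounds proportional to \<open>card V\<close> leaves at most
  \<open>a ^ m\<close> times the number of candidate sets unserved. There are only polynomially many
  candidates, so this is below 1 and hence 0.\<close>

lemma absorbing_set:
  fixes N L C :: nat
  assumes N: "0 < N" and L: "0 < L"
  shows "\<exists>n0. \<forall>(V :: 'a set) E. finite V \<longrightarrow> n0 \<le> card V \<longrightarrow>
     (\<exists>W\<subseteq>V. L * card W \<le> card V \<and> tileable E (mset_set W) \<and>
        (\<forall>D. D \<subseteq> V - W \<longrightarrow> card D \<le> C \<longrightarrow> reach V E N (mset_set D) {#} \<longrightarrow>
           tileable E (mset_set (W \<union> D))))"
proof -
  \<comment> \<open>With \<open>K * m \<le> card V\<close>, this \<open>K\<close> ensures both that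
    \<open>L * (m * N) \<le> card V\<close> and that the term with \<open>m\<close> in the size
    condition of \<open>absorber_family\<close> uses at most half of \<open>card V\<close>.\<close>
  define K where "K = 8 * N ^ 3 * L"
  define a where "a = 1 - 1 / (2 * real N * (real N + 1))"
  have K: "0 < K" using N L by (simp add: K_def)
  have "1 * 1 < (2 * real N) * (real N + 1)" using N by (intro mult_strict_mono) auto
  then have a: "0 < a" "a < 1" using N by (auto simp: a_def)
  have "(\<lambda>m. real (C + 1) * real K ^ C * (a ^ m * (real m + 1) ^ C)) \<longlonglongrightarrow> real (C + 1) * real K ^ C * 0"
    by (intro tendsto_mult tendsto_const exponential_beats_polynomial a)
  then have "eventually (\<lambda>m. real (C + 1) * real K ^ C * (a ^ m * (real m + 1) ^ C) < 1) sequentially"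
    by (intro order_tendstoD) auto
  then obtain m0 where m0: "\<And>m. m0 \<le> m \<Longrightarrow> real (C + 1) * real K ^ C * (a ^ m * (real m + 1) ^ C) < 1"
    unfolding eventually_sequentially by blast
  show ?thesis
  proof (intro exI[of _ "K * m0 + 4 * N * N * (N + C) + 1"] allI impI)
    fix V :: "'a set" and E
    assume V: "finite V" and large: "K * m0 + 4 * N * N * (N + C) + 1 \<le> card V"
    let ?n = "card V"
    define m where "m = ?n div K"
    have m: "m0 \<le> m" using large K unfolding m_def by (simp add: less_eq_div_iff_mult_less_eq mult.commute)
    have Km: "K * m \<le> ?n" unfolding m_def by simp
    have nK: "?n \<le> K * (m + 1)" unfolding m_def using K
      by (metis Suc_eq_plus1 dividend_less_times_div less_imp_le mult_Suc_right add.commute)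
    have big: "2 * N * N * (N + m * N + C) \<le> ?n"
    proof -
      have "4 * N ^ 3 * m \<le> K * m" unfolding K_def using L by (intro mult_le_mono1) simp
      then have "4 * N ^ 3 * m \<le> ?n" using Km by linarith
      moreover have "2 * (2 * N * N * (N + m * N + C)) = 4 * N ^ 3 * m + 4 * N * N * (N + C)"
        by (simp add: algebra_simps power3_eq_cube)
      moreover have "4 * N * N * (N + C) \<le> ?n" using large by linarith
      ultimately show ?thesis by linarith
    qed
    define \<D> where "\<D> = {D. D \<subseteq> V \<and> card D \<le> C \<and> reach V E N (mset_set D) {#}}"
    have "\<D> \<subseteq> {D. D \<subseteq> V \<and> card D \<le> C}" by (auto simp: \<D>_def)
    moreover have "finite {D. D \<subseteq> V \<and> card D \<le> C}" using V by simp
    ultimately have fin\<D>: "finite \<D>" and card\<D>: "card \<D> \<le> card {D. D \<subseteq> V \<and> card D \<le> C}"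
      by (auto intro: finite_subset card_mono)
    have Vne: "V \<noteq> {}" using large by auto
    have "\<forall>D\<in>\<D>. finite D \<and> card D \<le> C \<and> reach V E N (mset_set D) {#}"
      using V by (auto simp: \<D>_def intro: finite_subset)
    from absorber_family[OF V fin\<D> this big N]
    obtain W \<D>' where W: "W \<subseteq> V" "card W \<le> m * N" "tileable E (mset_set W)" "\<D>' \<subseteq> \<D>"
      "\<forall>D\<in>\<D> - \<D>'. W \<inter> D = {} \<longrightarrow> tileable E (mset_set (W \<union> D))"
      "real (card \<D>') \<le> a ^ m * real (card \<D>)" unfolding a_def by (elim exE conjE)
    have "real (card \<D>) \<le> real ((C + 1) * ?n ^ C)"
      using card\<D> card_small_subsets[OF V Vne, of C] by linarith
    also have "\<dots> \<le> real ((C + 1) * (K * (m + 1)) ^ C)"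
      using nK by (intro of_nat_mono mult_le_mono2 power_mono) auto
    finally have "a ^ m * real (card \<D>) \<le> a ^ m * real ((C + 1) * (K * (m + 1)) ^ C)"
      using a by (intro mult_left_mono) auto
    also have "\<dots> = real (C + 1) * real K ^ C * (a ^ m * (real m + 1) ^ C)"
      by (simp only: of_nat_mult of_nat_power power_mult_distrib of_nat_add of_nat_1 mult_ac)
    also have "\<dots> < 1" using m0[OF m] .
    finally have "card \<D>' = 0" using W(6) by linarith
    then have "\<D>' = {}" using W(4) fin\<D> by (metis card_0_eq finite_subset)
    have "L * card W \<le> L * (m * N)" using W(2) by (rule mult_le_mono2)
    also have "\<dots> \<le> K * m"
    proof -
      have "1 \<le> 8 * N * N" using N by simp
      then have "L * N * m * 1 \<le> L * N * m * (8 * N * N)" by (rule mult_le_mono2)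
      then show ?thesis by (simp add: K_def power3_eq_cube algebra_simps)
    qed
    finally have "L * card W \<le> ?n" using Km by linarith
    moreover have "tileable E (mset_set (W \<union> D))"
      if "D \<subseteq> V - W" "card D \<le> C" "reach V E N (mset_set D) {#}" for D
      using W(5) that \<open>\<D>' = {}\<close> by (auto simp: \<D>_def)
    ultimately show "\<exists>W\<subseteq>V. L * card W \<le> card V \<and> tileable E (mset_set W) \<and>
        (\<forall>D. D \<subseteq> V - W \<longrightarrow> card D \<le> C \<longrightarrow> reach V E N (mset_set D) {#} \<longrightarrow>
           tileable E (mset_set (W \<union> D)))"
      using W by blast
  qed
qed

section \<open>Degree conditions\<close>

lemma uniform_hypergraph_edge:
  assumes "uniform_hypergraph k V E" "e \<in> E"
  shows "e \<subseteq> V" "finite e" "card e = k"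
  using assms unfolding uniform_hypergraph_def nsets_def by auto

lemma tileable_edge_list:
  assumes "uniform_hypergraph k V E" "length w = k" "set w \<in> E"
  shows "tileable E (mset w)"
proof -
  have "distinct w"
    using uniform_hypergraph_edge(3)[OF assms(1,3)] assms(2) by (simp add: card_distinct)
  then have "mset w = mset_set (set w)" by (simp add: mset_set_set)
  then show ?thesis using tileable_edge[OF assms(3)] by simp
qed

lemma card_good_lists:
  assumes "finite V" "finite F" "card F \<le> 1" "s \<le> k" "V \<noteq> {}"
  shows "real (card V) ^ s * (1 - (real k + 1)\<^sup>2 / card V) \<le> card {T \<in> vlists V s. distinct T \<and> set T \<inter> F = {}}"
proof -
  let ?n = "card V"
  let ?B = "{T \<in> vlists V s. \<not> (distinct T \<and> set T \<inter> F = {})}"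
  let ?G = "{T \<in> vlists V s. distinct T \<and> set T \<inter> F = {}}"
  have n: "0 < real ?n" using assms by (simp add: card_gt_0_iff)
  have "?n * card ?B \<le> s * (s + card F) * ?n ^ s" using assms by (intro card_bad_lists)
  also have "\<dots> \<le> (k + 1) * (k + 1) * ?n ^ s" using assms by (intro mult_le_mono1 mult_le_mono) auto
  finally have "real (?n * card ?B) \<le> real ((k + 1) * (k + 1) * ?n ^ s)" by (rule of_nat_mono)
  then have B: "real (card ?B) \<le> (real k + 1)\<^sup>2 * real ?n ^ s / real ?n"
    using n by (simp add: field_simps power2_eq_square)
  have "vlists V s = ?G \<union> ?B" by blast
  then have "card (vlists V s) = card ?G + card ?B"
    using assms(1) by (subst card_Un_disjoint[symmetric]) auto
  then have "?n ^ s = card ?G + card ?B" by (simp only: card_vlists[OF assms(1)])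
  then have "real (?n ^ s) = real (card ?G + card ?B)" by (rule arg_cong)
  then have "real ?n ^ s = real (card ?G) + real (card ?B)"
    by (simp only: of_nat_add of_nat_power)
  moreover have "real ?n ^ s * (1 - (real k + 1)\<^sup>2 / ?n) =
      real ?n ^ s - (real k + 1)\<^sup>2 * real ?n ^ s / real ?n"
    by (simp only: right_diff_distrib mult_1_right times_divide_eq_right mult.commute)
  ultimately show ?thesis using B by linarith
qed

section \<open>Links of vertices and their overlaps\<close>

text \<open>A weak Bonferroni inequality: each pair is counted in both orders, which avoids ordering
  \<open>I\<close> and costs only a constant factor.\<close>

lemma sum_card_le_card_Union:
  assumes "finite I" "\<And>i. i \<in> I \<Longrightarrow> finite (D i)"
  shows "(\<Sum>i\<in>I. card (D i)) \<le> card (\<Union>i\<in>I. D i) + (\<Sum>i\<in>I. \<Sum>j\<in>I - {i}. card (D i \<inter> D j))"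
  using assms
proof (induction I rule: finite_induct)
  case (insert a I)
  let ?U = "\<Union>i\<in>I. D i"
  have fin: "finite (D a)" "finite ?U" using insert by auto
  have "card (D a) + card ?U = card (D a \<union> ?U) + card (D a \<inter> ?U)"
    using fin by (rule card_Un_Int)
  moreover have "card (D a \<inter> ?U) \<le> (\<Sum>j\<in>I. card (D a \<inter> D j))"
    unfolding Int_UN_distrib using insert by (intro card_UN_le)
  moreover have "(\<Sum>i\<in>I. card (D i)) \<le> card ?U + (\<Sum>i\<in>I. \<Sum>j\<in>I - {i}. card (D i \<inter> D j))"
    using insert by auto
  moreover have "(\<Sum>i\<in>I. \<Sum>j\<in>I - {i}. card (D i \<inter> D j)) \<le> (\<Sum>i\<in>I. \<Sum>j\<in>insert a I - {i}. card (D i \<inter> D j))"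
    using insert by (intro sum_mono sum_mono2) auto
  moreover have "insert a I - {a} = I" using insert by auto
  ultimately show ?case using insert by simp
qed simp

text \<open>Ordered tuples fit directly into \<open>exch\<close>. For \<open>0 < k\<close>,
  uniformity forces the entries to be distinct and different from \<open>v\<close>.\<close>

definition link_lists :: "nat \<Rightarrow> 'a set \<Rightarrow> 'a set set \<Rightarrow> 'a \<Rightarrow> 'a list set" where
  "link_lists k V E v = {T \<in> vlists V (k - 1). insert v (set T) \<in> E}"

lemma finite_link_lists [simp]: "finite V \<Longrightarrow> finite (link_lists k V E v)"
  by (simp add: link_lists_def)

lemma link_list_set:
  assumes "uniform_hypergraph k V E" "0 < k" "T \<in> link_lists k V E v"
  shows "set T \<subseteq> V" "card (set T) = k - 1"
proof -
  show "set T \<subseteq> V" using assms by (auto simp: link_lists_def vlists_def)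
  have "card (insert v (set T)) = k"
    using uniform_hypergraph_edge(3)[OF assms(1)] assms(3) by (simp add: link_lists_def)
  moreover have "card (set T) \<le> k - 1"
    using card_length[of T] assms(3) by (simp add: link_lists_def vlists_def)
  ultimately show "card (set T) = k - 1"
    using card_insert_le_m1[of k "set T" v] assms(2) by (cases "v \<in> set T") (auto simp: insert_absorb)
qed

text \<open>A tuple in both links forms an edge with either vertex, so it is an exchange tuple;
  \<open>k \<le> N\<close> takes care of its length.\<close>

lemma reach_if_common_links:
  assumes H: "uniform_hypergraph k V E" and k: "0 < k" "k \<le> N"
    and le: "card V ^ (k - 1) \<le> N * card (link_lists k V E u \<inter> link_lists k V E v)"
  shows "reach V E N {#u#} {#v#}"
proof -
  have V: "finite V" using H by (simp add: uniform_hypergraph_def)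
  have "tileable E (mset T + {#w#})" if "T \<in> link_lists k V E w" for T w
    using tileable_edge_list[OF H, of "w # T"] that k by (simp add: link_lists_def vlists_def)
  then have "link_lists k V E u \<inter> link_lists k V E v \<subseteq> exch V E (k - 1) {#u#} {#v#}"
    by (auto simp: exch_def) (auto simp: link_lists_def)
  then have "card (link_lists k V E u \<inter> link_lists k V E v) \<le> card (exch V E (k - 1) {#u#} {#v#})"
    using V by (intro card_mono) auto
  then show ?thesis using le k unfolding reach_def
    by (intro exI[of _ "k - 1"]) (auto intro: order_trans mult_le_mono2)
qed

text \<open>Choose \<open>k - 2\<close> distinct vertices other than \<open>v\<close> and apply the
  degree condition to them together with \<open>v\<close>. The loss \<open>g\<close> pays for the
  excluded choices.\<close>

lemma card_link_lists:
  fixes d g :: real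
  assumes H: "uniform_hypergraph k V E" and k: "2 \<le> k" and V: "V \<noteq> {}" and d: "0 \<le> d"
    and deg: "\<And>S. S \<subseteq> V \<Longrightarrow> card S = k - 1 \<Longrightarrow> d * card V \<le> card {x \<in> V. insert x S \<in> E}"
    and large: "d * (real k + 1)\<^sup>2 \<le> g * card V" and v: "v \<in> V"
  shows "(d - g) * real (card V) ^ (k - 1) \<le> card (link_lists k V E v)"
proof -
  let ?n = "card V"
  let ?G = "{T \<in> vlists V (k - 2). distinct T \<and> set T \<inter> {v} = {}}"
  have fV: "finite V" using H by (simp add: uniform_hypergraph_def)
  have n: "0 < real ?n" using V fV by (simp add: card_gt_0_iff)
  have fG: "finite ?G" using fV by simp
  let ?S = "SIGMA T:?G. {x \<in> V. insert x (insert v (set T)) \<in> E}"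
  have "(\<lambda>(T, x). x # T) ` ?S \<subseteq> link_lists k V E v"
    using k by (auto simp: link_lists_def vlists_def insert_commute)
  moreover have inj: "inj_on (\<lambda>(T, x). x # T) ?S" by (auto intro!: inj_onI)
  ultimately have le: "card ?S \<le> card (link_lists k V E v)"
    using fV by (metis (no_types, lifting) card_image card_mono finite_link_lists)
  have step: "d * ?n \<le> card {x \<in> V. insert x (insert v (set T)) \<in> E}" if "T \<in> ?G" for T
  proof (rule deg)
    show "insert v (set T) \<subseteq> V" using that v by (auto simp: vlists_def)
    show "card (insert v (set T)) = k - 1"
      using that k distinct_card[of T] by (auto simp: vlists_def)
  qed
  have "d - g \<le> d * (1 - (real k + 1)\<^sup>2 / ?n)"
    using large n by (simp add: field_simps)
  then have "(d - g) * real ?n ^ (k - 1) \<le> d * (1 - (real k + 1)\<^sup>2 / ?n) * real ?n ^ (k - 1)"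
    by (intro mult_right_mono) auto
  also have "\<dots> = real ?n ^ (k - 2) * (1 - (real k + 1)\<^sup>2 / ?n) * (d * ?n)"
  proof -
    have "k - 1 = Suc (k - 2)" using k by simp
    then show ?thesis by (simp only: power_Suc mult_ac)
  qed
  also have "\<dots> \<le> real (card ?G) * (d * ?n)"
    using card_good_lists[OF fV, of "{v}" "k - 2" k] V d by (intro mult_right_mono) auto
  also have "\<dots> = (\<Sum>T\<in>?G. d * ?n)" by simp
  also have "\<dots> \<le> (\<Sum>T\<in>?G. real (card {x \<in> V. insert x (insert v (set T)) \<in> E}))"
    using step by (rule sum_mono)
  also have "\<dots> = real (card ?S)" using fG fV by simp
  also have "\<dots> \<le> card (link_lists k V E v)" using le by simp
  finally show ?thesis .
qed

text \<open>Pairs of a tuple \<open>T\<close> and a vertex \<open>u\<close> with \<open>T\<close> in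
  the links of both \<open>v\<close> and \<open>u\<close> are counted twice. Each \<open>T\<close>
  gives at least \<open>d * card V\<close> vertices; vertices with few common tuples account for at
  most \<open>card V ^ k / N\<close> pairs, a fraction \<open>1 / (c * N)\<close> of
  \<open>card V\<close> per tuple in the link of \<open>v\<close>.\<close>

lemma card_close_vertices:
  fixes d c :: real
  assumes H: "uniform_hypergraph k V E" and k: "2 \<le> k" and V: "V \<noteq> {}" and c: "0 < c"
    and deg: "\<And>S. S \<subseteq> V \<Longrightarrow> card S = k - 1 \<Longrightarrow> d * card V \<le> card {x \<in> V. insert x S \<in> E}"
    and link: "c * real (card V) ^ (k - 1) \<le> card (link_lists k V E v)" and N: "0 < N"
  shows "(d - 1 / (c * N)) * card V \<le>
    card {u \<in> V. card V ^ (k - 1) \<le> N * card (link_lists k V E v \<inter> link_lists k V E u)}"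
proof -
  let ?n = "card V" and ?L = "link_lists k V E"
  let ?X = "{u \<in> V. ?n ^ (k - 1) \<le> N * card (?L v \<inter> ?L u)}"
  have fV: "finite V" using H by (simp add: uniform_hypergraph_def)
  have n: "0 < real ?n" using V fV by (simp add: card_gt_0_iff)
  have "(\<Sum>u\<in>V. card {T \<in> ?L v. T \<in> ?L u}) = (\<Sum>T\<in>?L v. card {u \<in> V. T \<in> ?L u})"
    using fV by (intro sum_multicount_gen[symmetric]) auto
  moreover have "{T \<in> ?L v. T \<in> ?L u} = ?L v \<inter> ?L u" for u by blast
  ultimately have dbl: "(\<Sum>u\<in>V. card (?L v \<inter> ?L u)) = (\<Sum>T\<in>?L v. card {u \<in> V. T \<in> ?L u})" by simp
  have "d * ?n \<le> card {u \<in> V. T \<in> ?L u}" if T: "T \<in> ?L v" for T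
  proof -
    have "{u \<in> V. T \<in> ?L u} = {x \<in> V. insert x (set T) \<in> E}" using T by (auto simp: link_lists_def)
    then show ?thesis using deg[of "set T"] link_list_set[OF H _ T] k by simp
  qed
  then have "(\<Sum>T\<in>?L v. d * ?n) \<le> (\<Sum>T\<in>?L v. real (card {u \<in> V. T \<in> ?L u}))" by (rule sum_mono)
  then have lower: "card (?L v) * (d * ?n) \<le> (\<Sum>u\<in>V. real (card (?L v \<inter> ?L u)))"
    unfolding of_nat_sum[symmetric] dbl by simp
  have "real (card (?L v \<inter> ?L u)) \<le> (if u \<in> ?X then real (card (?L v)) else 0) + real ?n ^ (k - 1) / N"
    if "u \<in> V" for u
  proof (cases "u \<in> ?X")
    case True
    have "card (?L v \<inter> ?L u) \<le> card (?L v)" using fV by (intro card_mono) auto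
    moreover have "0 \<le> real ?n ^ (k - 1) / N" by simp
    ultimately show ?thesis using True by (simp add: add_increasing2)
  next
    case False
    then have "N * card (?L v \<inter> ?L u) \<le> ?n ^ (k - 1)" using that by auto
    then have "real (N * card (?L v \<inter> ?L u)) \<le> real (?n ^ (k - 1))" by (rule of_nat_mono)
    then have "real (card (?L v \<inter> ?L u)) \<le> real ?n ^ (k - 1) / N"
      using N by (simp add: field_simps)
    then show ?thesis using False by simp
  qed
  then have "(\<Sum>u\<in>V. real (card (?L v \<inter> ?L u))) \<le>
      (\<Sum>u\<in>V. (if u \<in> ?X then real (card (?L v)) else 0) + real ?n ^ (k - 1) / N)" by (rule sum_mono)
  also have "\<dots> = (\<Sum>u\<in>V. if u \<in> ?X then real (card (?L v)) else 0) + ?n * (real ?n ^ (k - 1) / N)"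
    by (simp only: sum.distrib sum_constant)
  also have "(\<Sum>u\<in>V. if u \<in> ?X then real (card (?L v)) else 0) = (\<Sum>u\<in>?X. real (card (?L v)))"
    using fV by (subst sum.inter_filter[symmetric]) (auto intro: sum.cong)
  also have "\<dots> = card ?X * real (card (?L v))" by simp
  finally have "card (?L v) * (d * ?n) \<le> card ?X * real (card (?L v)) + ?n * (real ?n ^ (k - 1) / N)"
    using lower by linarith
  moreover have "?n * (real ?n ^ (k - 1) / N) \<le> card (?L v) * (?n / (c * N))"
  proof -
    have "real ?n ^ (k - 1) \<le> card (?L v) / c" using link c by (simp add: field_simps)
    then have "?n * (real ?n ^ (k - 1) / N) \<le> ?n * ((card (?L v) / c) / N)"
      by (intro mult_left_mono divide_right_mono) auto
    then show ?thesis by (simp add: mult_ac)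
  qed
  ultimately have "card (?L v) * (d * ?n) \<le> card (?L v) * (card ?X + ?n / (c * N))"
    by (simp add: algebra_simps)
  moreover have "0 < real (card (?L v))" using link c n by (smt (verit) mult_pos_pos zero_less_power)
  ultimately have "d * ?n \<le> card ?X + ?n / (c * N)" by simp
  then show ?thesis by (simp add: algebra_simps)
qed

text \<open>All links live among \<open>card V ^ (k - 1)\<close> tuples, so \<open>p\<close> links
  of density \<open>c\<close> cannot be almost disjoint when \<open>p * c\<close> exceeds 1 by more
  than the total \<open>p\<^sup>2 / N\<close> allowed for pairwise overlaps.\<close>

lemma close_pair_exists:
  fixes c :: real
  assumes V: "finite V" "V \<noteq> {}" and I: "I \<subseteq> V" "card I = p" "0 < p"
    and link: "\<And>v. v \<in> V \<Longrightarrow> c * real (card V) ^ (k - 1) \<le> card (link_lists k V E v)"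
    and N: "0 < N" and c: "1 + real p ^ 2 / N < p * c"
  shows "\<exists>u\<in>I. \<exists>v\<in>I. u \<noteq> v \<and> card V ^ (k - 1) \<le> N * card (link_lists k V E u \<inter> link_lists k V E v)"
proof (rule ccontr)
  let ?n = "card V" and ?L = "link_lists k V E"
  assume no: "\<not> ?thesis"
  have n: "0 < real ?n ^ (k - 1)" using V by (simp add: card_gt_0_iff)
  have fI: "finite I" using I V finite_subset by blast
  have small: "real (card (?L u \<inter> ?L v)) \<le> real ?n ^ (k - 1) / N" if "u \<in> I" "v \<in> I - {u}" for u v
  proof -
    have "u \<in> I" "v \<in> I" "u \<noteq> v" using that by auto
    then have "\<not> ?n ^ (k - 1) \<le> N * card (?L u \<inter> ?L v)" using no by meson
    then have "N * card (?L u \<inter> ?L v) \<le> ?n ^ (k - 1)" by (simp only: not_le less_imp_le)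
    then have "real (N * card (?L u \<inter> ?L v)) \<le> real (?n ^ (k - 1))" by (rule of_nat_mono)
    then show ?thesis using N by (simp add: field_simps)
  qed
  have "p * (c * real ?n ^ (k - 1)) = (\<Sum>v\<in>I. c * real ?n ^ (k - 1))" using I by simp
  also have "\<dots> \<le> (\<Sum>v\<in>I. real (card (?L v)))" using link I by (intro sum_mono) auto
  also have "\<dots> \<le> real (card (\<Union>i\<in>I. ?L i) + (\<Sum>i\<in>I. \<Sum>j\<in>I - {i}. card (?L i \<inter> ?L j)))"
    unfolding of_nat_sum[symmetric] using fI V by (intro of_nat_mono sum_card_le_card_Union) auto
  also have "\<dots> = real (card (\<Union>i\<in>I. ?L i)) + (\<Sum>i\<in>I. \<Sum>j\<in>I - {i}. real (card (?L i \<inter> ?L j)))"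
    by simp
  also have "\<dots> \<le> real ?n ^ (k - 1) + (\<Sum>i\<in>I. \<Sum>j\<in>I - {i}. real ?n ^ (k - 1) / N)"
  proof (rule add_mono)
    have "(\<Union>i\<in>I. ?L i) \<subseteq> vlists V (k - 1)" by (auto simp: link_lists_def)
    then have "card (\<Union>i\<in>I. ?L i) \<le> ?n ^ (k - 1)"
      using V card_vlists[OF V(1)] card_mono finite_vlists by metis
    then show "real (card (\<Union>i\<in>I. ?L i)) \<le> real ?n ^ (k - 1)"
      by (metis of_nat_mono of_nat_power)
  qed (use small in \<open>intro sum_mono\<close>)
  also have "\<dots> \<le> real ?n ^ (k - 1) + (\<Sum>i\<in>I. real p * (real ?n ^ (k - 1) / N))"
  proof (intro add_mono sum_mono order_refl)
    fix i
    have "card (I - {i}) \<le> p" using card_Diff1_le[of I i] I by simp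
    then show "(\<Sum>j\<in>I - {i}. real ?n ^ (k - 1) / N) \<le> real p * (real ?n ^ (k - 1) / N)"
      by (simp only: sum_constant) (intro mult_right_mono, auto)
  qed
  also have "\<dots> = real ?n ^ (k - 1) * (1 + real p ^ 2 / N)"
    using I by (simp add: algebra_simps power2_eq_square)
  also have "\<dots> < real ?n ^ (k - 1) * (p * c)" using n c by (rule mult_strict_left_mono[rotated])
  finally show False by (simp add: mult_ac)
qed

section \<open>Dense index vectors\<close>

lemma card_lists_with_labels:
  assumes V: "finite V" and part: "\<And>j. j \<in> set l \<Longrightarrow> card V \<le> p * card {u \<in> V. lab u = j}"
  shows "card V ^ length l \<le> p ^ length l * card {T \<in> vlists V (length l). map lab T = l}"
  using part
proof (induction l)
  case Nil
  have "{T \<in> vlists V 0. map lab T = []} = {[]}" by (auto simp: vlists_def)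
  then show ?case by simp
next
  case (Cons j l)
  let ?A = "{u \<in> V. lab u = j}" and ?B = "{T \<in> vlists V (length l). map lab T = l}"
  have "{T \<in> vlists V (length (j # l)). map lab T = j # l} = (\<lambda>(x, T). x # T) ` (?A \<times> ?B)"
    by (auto simp: vlists_def length_Suc_conv image_iff)
  moreover have "inj_on (\<lambda>(x, T). x # T) (?A \<times> ?B)" by (auto intro!: inj_onI)
  ultimately have eq: "card {T \<in> vlists V (length (j # l)). map lab T = j # l} = card ?A * card ?B"
    by (simp add: card_image card_cartesian_product)
  have "card V ^ length (j # l) = card V * card V ^ length l" by simp
  also have "\<dots> \<le> (p * card ?A) * (p ^ length l * card ?B)"
    using Cons by (intro mult_le_mono) auto
  also have "\<dots> = p ^ length (j # l) * (card ?A * card ?B)" by (simp add: mult_ac)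
  finally show ?case unfolding eq .
qed

text \<open>Tuples following the label pattern \<open>w\<close> are extended by the degree
  condition, and a most frequent label of the new vertex is kept. The inverse density collects
  \<open>p ^ (k - 1)\<close> for the pattern, 2 for distinctness, \<open>p\<close> for the degree
  and \<open>p\<close> for the choice of label.\<close>

lemma dense_label_extension:
  assumes H: "uniform_hypergraph k V E" and k: "2 \<le> k" and V: "V \<noteq> {}" and p: "0 < p" "r \<le> p"
    and deg: "\<And>S. S \<subseteq> V \<Longrightarrow> card S = k - 1 \<Longrightarrow> card V \<le> p * card {x \<in> V. insert x S \<in> E}"
    and part: "\<And>j. j < r \<Longrightarrow> card V \<le> p * card {u \<in> V. lab u = j}"
    and lab: "\<And>u. u \<in> V \<Longrightarrow> lab u < r"
    and large: "2 * p ^ k * (k * k) \<le> card V"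
    and w: "size w = k - 1" "set_mset w \<subseteq> {..<r}"
  shows "\<exists>j<r. card V ^ k \<le> 2 * p ^ (k + 1) *
    card {w' \<in> vlists V k. tileable E (mset w') \<and> image_mset lab (mset w') = add_mset j w}"
proof -
  let ?n = "card V"
  have fV: "finite V" using H by (simp add: uniform_hypergraph_def)
  have n: "0 < ?n" using V fV by (simp add: card_gt_0_iff)
  obtain l where l: "mset l = w" using ex_mset by blast
  have len: "length l = k - 1" using w l by auto
  let ?All = "{T \<in> vlists V (k - 1). map lab T = l}"
  let ?B = "{T \<in> vlists V (k - 1). \<not> (distinct T \<and> set T \<inter> {} = {})}"
  let ?A = "{T \<in> vlists V (k - 1). map lab T = l \<and> distinct T}"
  have fA: "finite ?A" using fV by simp
  have all: "?n ^ (k - 1) \<le> p ^ (k - 1) * card ?All"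
    unfolding len[symmetric] using fV
  proof (rule card_lists_with_labels)
    fix j assume "j \<in> set l"
    then show "?n \<le> p * card {u \<in> V. lab u = j}" using part w l by auto
  qed
  have "?n * card ?B \<le> (k - 1) * (k - 1 + card ({} :: 'a set)) * ?n ^ (k - 1)"
    using fV by (intro card_bad_lists) auto
  also have "\<dots> \<le> k * k * ?n ^ (k - 1)" by (intro mult_le_mono1 mult_le_mono) auto
  finally have "2 * p ^ (k - 1) * (?n * card ?B) \<le> 2 * p ^ (k - 1) * (k * k * ?n ^ (k - 1))"
    by (rule mult_le_mono2)
  also have "\<dots> \<le> 2 * p ^ k * (k * k * ?n ^ (k - 1))"
    using p by (intro mult_le_mono1 mult_le_mono2 power_increasing) auto
  also have "\<dots> = 2 * p ^ k * (k * k) * ?n ^ (k - 1)" by (simp only: mult_ac)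
  also have "\<dots> \<le> ?n * ?n ^ (k - 1)" using large by (rule mult_le_mono1)
  finally have "?n * (2 * p ^ (k - 1) * card ?B) \<le> ?n * ?n ^ (k - 1)" by (simp only: mult_ac)
  then have B: "2 * p ^ (k - 1) * card ?B \<le> ?n ^ (k - 1)" using n by simp
  have "?All \<subseteq> ?A \<union> ?B" by auto
  then have "card ?All \<le> card (?A \<union> ?B)" using fV by (intro card_mono) auto
  also have "\<dots> \<le> card ?A + card ?B" by (rule card_Un_le)
  finally have "2 * p ^ (k - 1) * card ?All \<le> 2 * p ^ (k - 1) * (card ?A + card ?B)" by (rule mult_le_mono2)
  then have "2 * p ^ (k - 1) * card ?All \<le> 2 * p ^ (k - 1) * card ?A + 2 * p ^ (k - 1) * card ?B"
    by (simp only: distrib_left)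
  then have A: "?n ^ (k - 1) \<le> 2 * p ^ (k - 1) * card ?A" using all B by linarith
  let ?S = "SIGMA T:?A. {x \<in> V. insert x (set T) \<in> E}"
  have step: "?n \<le> p * card {x \<in> V. insert x (set T) \<in> E}" if "T \<in> ?A" for T
    using that distinct_card[of T] by (intro deg) (auto simp: vlists_def)
  have "card ?A * ?n = (\<Sum>T\<in>?A. ?n)" by simp
  also have "\<dots> \<le> (\<Sum>T\<in>?A. p * card {x \<in> V. insert x (set T) \<in> E})"
    using step by (rule sum_mono)
  also have "\<dots> = p * card ?S" using fA fV by (simp add: sum_distrib_left)
  finally have S: "card ?A * ?n \<le> p * card ?S" .
  have "?n ^ k = ?n ^ (k - 1) * ?n" using k by (metis One_nat_def Suc_1 Suc_leD Suc_pred' less_eq_Suc_le power_Suc2 diff_Suc_1)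
  also have "\<dots> \<le> 2 * p ^ (k - 1) * card ?A * ?n" using A by (rule mult_le_mono1)
  also have "\<dots> \<le> 2 * p ^ (k - 1) * (p * card ?S)" using S by (simp add: mult.assoc)
  also have "\<dots> = 2 * p ^ k * card ?S"
  proof -
    have "p ^ k = p * p ^ (k - 1)" using k by (cases k) auto
    then show ?thesis by simp
  qed
  finally have nS: "?n ^ k \<le> 2 * p ^ k * card ?S" .
  have fS: "finite ?S" using fA fV by simp
  obtain j where j: "j \<le> r - 1" "card ?S \<le> (r - 1 + 1) * card {z \<in> ?S. lab (snd z) = j}"
    using pigeonhole_fraction[OF fS, of "\<lambda>z. lab (snd z)" "r - 1"] lab by fastforce
  have r: "0 < r" using lab V by fastforce
  let ?C = "{w' \<in> vlists V k. tileable E (mset w') \<and> image_mset lab (mset w') = add_mset j w}"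
  have "(\<lambda>(T, x). x # T) ` {z \<in> ?S. lab (snd z) = j} \<subseteq> ?C"
  proof
    fix L assume "L \<in> (\<lambda>(T, x). x # T) ` {z \<in> ?S. lab (snd z) = j}"
    then obtain T x where L: "L = x # T" "T \<in> vlists V (k - 1)" "map lab T = l" "x \<in> V"
      "insert x (set T) \<in> E" "lab x = j" by auto
    then have lenL: "length L = k" using k by (simp add: vlists_def)
    moreover have "tileable E (mset L)" using L lenL by (intro tileable_edge_list[OF H]) auto
    moreover have "image_mset lab (mset L) = add_mset j w" using L l by (metis mset_map list.simps(9) mset.simps(2))
    ultimately show "L \<in> ?C" using L by (auto simp: vlists_def)
  qed
  then have "card ((\<lambda>(T, x). x # T) ` {z \<in> ?S. lab (snd z) = j}) \<le> card ?C"
    using fV by (intro card_mono) auto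
  moreover have "inj_on (\<lambda>(T, x). x # T) {z \<in> ?S. lab (snd z) = j}" by (auto intro!: inj_onI)
  ultimately have "card {z \<in> ?S. lab (snd z) = j} \<le> card ?C" by (simp add: card_image)
  then have "r * card {z \<in> ?S. lab (snd z) = j} \<le> p * card ?C" by (rule mult_le_mono[OF p(2)])
  moreover have "r - 1 + 1 = r" using r by simp
  ultimately have "card ?S \<le> p * card ?C" using j(2) by (simp only: order_trans)
  then have "2 * p ^ k * card ?S \<le> 2 * p ^ k * (p * card ?C)" by (rule mult_le_mono2)
  also have "\<dots> = 2 * p ^ (k + 1) * card ?C" by simp
  finally have "?n ^ k \<le> 2 * p ^ (k + 1) * card ?C" using nS by (rule order_trans[rotated])
  then show ?thesis using j r by (intro exI[of _ j]) auto
qed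

section \<open>The partition of a dense hypergraph\<close>

lemma hypergraph_partition:
  fixes k p :: nat and \<gamma> :: real
  assumes k: "2 \<le> k" and p: "0 < p" and g: "0 < \<gamma>"
  shows "\<exists>N n0. \<forall>(V :: 'a set) E. uniform_hypergraph k V E \<longrightarrow> n0 \<le> card V \<longrightarrow>
     (\<forall>S. S \<subseteq> V \<longrightarrow> card S = k - 1 \<longrightarrow> (1 / p + \<gamma>) * card V \<le> card {x \<in> V. insert x S \<in> E}) \<longrightarrow>
     (\<exists>r (lab :: 'a \<Rightarrow> nat). 0 < r \<and> r < p \<and> lab ` V \<subseteq> {..<r} \<and>
        (\<forall>u\<in>V. \<forall>v\<in>V. lab u = lab v \<longrightarrow> reach V E N {#u#} {#v#}) \<and>
        (\<forall>j<r. (1 / p + \<gamma> / 4) * card V \<le> card {u \<in> V. lab u = j}))"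
proof -
  define d where "d = 1 / p + \<gamma>"
  \<comment> \<open>\<open>c\<close> is the density kept after losing \<open>\<gamma> / 2\<close>.
    It serves both for the links and for the level 0 neighbourhoods; the final part sizes lose a
    further \<open>\<gamma> / 4\<close>.\<close>
  define c where "c = 1 / p + \<gamma> / 2"
  have dc: "0 < d" "0 < c" "1 / p \<le> c" using p g by (auto simp: d_def c_def add_pos_pos)
  \<comment> \<open>As \<open>c \<ge> 1 / p\<close>, the term \<open>2 * p / \<gamma>\<close> limits
    the loss \<open>1 / (c * N0)\<close> to \<open>\<gamma> / 2\<close> and makes
    \<open>1 + p\<^sup>2 / N0\<close> smaller than \<open>p * c\<close>.\<close>
  obtain N0 where N0: "real k + 1 + real p + 2 * real p / \<gamma> < real N0" by (meson reals_Archimedean2)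
  have "0 \<le> 2 * real p / \<gamma>" using g by simp
  then have N0': "k \<le> N0" "p \<le> N0" "0 < N0" "2 * real p / \<gamma> < N0" using N0 by linarith+
  then have N0g: "2 * real p < \<gamma> * N0" using g by (simp add: field_simps)
  \<comment> \<open>The second term makes the overlap \<open>p * card V / M\<close> of parts at most
    \<open>\<gamma> / 4 * card V\<close>.\<close>
  obtain M where M: "real (p\<^sup>2 * (p + 1)) + 4 * real p / \<gamma> < real M" by (meson reals_Archimedean2)
  have "0 \<le> 4 * real p / \<gamma>" using g by simp
  then have M': "p\<^sup>2 * (p + 1) \<le> M" "4 * real p / \<gamma> < M" "0 < M" using M by linarith+
  then have Mg: "4 * real p < \<gamma> * M" using g by (simp add: field_simps)
  \<comment> \<open>The bound of \<open>reach_compose\<close> for intermediate tuples of length 1,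
    so that passing to the next level is one composition through vertices.\<close>
  define next_N where "next_N N = 1 + (N + 1) * (N + 1) + M * ((N + 1) * (N + 1) + 1) * ((N + 1) * (N + 1))" for N
  define Ns where "Ns i = (next_N ^^ i) N0" for i
  have Ns0: "Ns 0 = N0" by (simp add: Ns_def)
  have NsSuc: "Ns (Suc i) = next_N (Ns i)" for i by (simp add: Ns_def)
  have next_ge: "N \<le> next_N N" for N by (simp add: next_N_def)
  have Ns_ge: "N0 \<le> Ns i" for i
    by (induction i) (use Ns0 NsSuc next_ge le_trans in \<open>auto intro: le_trans\<close>)
  obtain n0 where n0: "2 * (d * (real k + 1)\<^sup>2) / \<gamma> + 1 < real n0" by (meson reals_Archimedean2)
  show ?thesis
  proof (rule exI[of _ "Ns (2 * p + 3)"], rule exI[of _ n0], intro allI impI)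
    fix V :: "'a set" and E
    assume H: "uniform_hypergraph k V E" and n: "n0 \<le> card V"
      and deg': "\<forall>S. S \<subseteq> V \<longrightarrow> card S = k - 1 \<longrightarrow> (1 / p + \<gamma>) * card V \<le> card {x \<in> V. insert x S \<in> E}"
    let ?n = "card V" and ?L = "link_lists k V E"
    have fV: "finite V" using H by (simp add: uniform_hypergraph_def)
    have deg: "d * ?n \<le> card {x \<in> V. insert x S \<in> E}" if "S \<subseteq> V" "card S = k - 1" for S
      using deg' that by (simp add: d_def)
    have "0 \<le> 2 * (d * (real k + 1)\<^sup>2) / \<gamma>" using g dc by simp
    then have n1: "2 * (d * (real k + 1)\<^sup>2) / \<gamma> < ?n" "0 < ?n" using n0 n by linarith+
    then have large: "d * (real k + 1)\<^sup>2 \<le> \<gamma> / 2 * ?n" using g by (simp add: field_simps)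
    have V: "V \<noteq> {}" using n1 by auto
    have link: "c * real ?n ^ (k - 1) \<le> card (?L v)" if "v \<in> V" for v
    proof -
      have "(d - \<gamma> / 2) * real ?n ^ (k - 1) \<le> card (?L v)"
        by (rule card_link_lists[OF H k V less_imp_le[OF dc(1)] _ large that]) (rule deg)
      moreover have "d - \<gamma> / 2 = c" by (simp add: d_def c_def)
      ultimately show ?thesis by simp
    qed
    define Rel where "Rel i u v \<longleftrightarrow> reach V E (Ns i) {#u#} {#v#}" for i u v
    have Rel0: "Rel 0 u v" if "?n ^ (k - 1) \<le> N0 * card (?L u \<inter> ?L v)" for u v
      unfolding Rel_def Ns0 using reach_if_common_links[OF H _ N0'(1) that] k by simp
    have Rel_mono: "Rel i u v \<Longrightarrow> Rel (Suc i) u v" for i u v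
      unfolding Rel_def NsSuc using next_ge reach_mono by blast
    \<comment> \<open>Even reflexivity needs dense exchange tuples; the link of \<open>u\<close>
      supplies them.\<close>
    have Rel_refl: "Rel i u u" if "u \<in> V" for i u
    proof (induction i)
      case 0
      have "1 / p * real ?n ^ (k - 1) \<le> c * real ?n ^ (k - 1)" using dc by (intro mult_right_mono) auto
      then have "1 / p * real ?n ^ (k - 1) \<le> card (?L u)" using link[OF that] by (rule order_trans)
      then have "real ?n ^ (k - 1) \<le> p * real (card (?L u))" using p by (simp add: field_simps)
      also have "\<dots> \<le> N0 * real (card (?L u))" using N0' by (intro mult_right_mono) auto
      finally have "real (?n ^ (k - 1)) \<le> real (N0 * card (?L u))" by simp
      then have "?n ^ (k - 1) \<le> N0 * card (?L u)" by (simp only: of_nat_le_iff)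
      then show ?case by (intro Rel0) simp
    qed (rule Rel_mono)
    have close: "c * ?n \<le> card {u \<in> V. Rel 0 v u}" if v: "v \<in> V" for v
    proof -
      have "1 / (c * N0) \<le> 1 / (1 / p * N0)"
        using dc N0' p by (intro divide_left_mono mult_right_mono) auto
      also have "\<dots> \<le> \<gamma> / 2" using N0g N0'(3) p by (simp add: field_simps)
      finally have "c \<le> d - 1 / (c * N0)" by (simp add: c_def d_def)
      then have "c * ?n \<le> (d - 1 / (c * N0)) * ?n" by (intro mult_right_mono) auto
      also have "\<dots> \<le> card {u \<in> V. ?n ^ (k - 1) \<le> N0 * card (?L v \<inter> ?L u)}"
        by (rule card_close_vertices[OF H k V dc(2) _ link[OF v] N0'(3)]) (rule deg)
      also have "\<dots> \<le> card {u \<in> V. Rel 0 v u}"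
        using fV Rel0 by (intro of_nat_mono card_mono) auto
      finally show ?thesis .
    qed
    have Rel_step: "Rel (Suc i) u v"
      if uv: "u \<in> V" "v \<in> V" "?n \<le> M * card {w \<in> V. Rel i u w \<and> Rel i w v}" for i u v
    proof -
      let ?A = "(\<lambda>w. [w]) ` {w \<in> V. Rel i u w \<and> Rel i w v}"
      have "card ?A = card {w \<in> V. Rel i u w \<and> Rel i w v}" by (intro card_image) (auto intro: inj_onI)
      then have "?n ^ 1 \<le> M * card ?A" using uv by simp
      moreover have "?A \<subseteq> vlists V 1" by (auto simp: vlists_def)
      ultimately show ?thesis unfolding Rel_def NsSuc next_N_def
        by (intro reach_compose[OF fV, of ?A]) (auto simp: Rel_def)
    qed
    have "\<exists>A lab. A \<subseteq> V \<and> card A < p \<and> (\<forall>u\<in>V. lab u \<in> A) \<and>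
           (\<forall>u\<in>V. \<forall>v\<in>V. lab u = lab v \<longrightarrow> Rel (2 * p + 3) u v) \<and>
           (\<forall>a\<in>A. M * card {w \<in> V. Rel 0 a w} \<le> M * card {u \<in> V. lab u = a} + p * card V)"
    proof (rule dense_reachability_partition[OF fV V _ _ _ _ _ _ M'(1)])
      show "u \<in> V \<Longrightarrow> Rel i u u" for i u by (rule Rel_refl)
      show "Rel i u v \<Longrightarrow> Rel (Suc i) u v" for i u v by (rule Rel_mono)
      show "u \<in> V \<Longrightarrow> v \<in> V \<Longrightarrow> ?n \<le> M * card {w \<in> V. Rel i u w \<and> Rel i w v} \<Longrightarrow> Rel (Suc i) u v"
        for i u v by (rule Rel_step)
      show "Rel i u v \<Longrightarrow> Rel i v u" for i u v unfolding Rel_def by (rule reach_sym)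
      show "?n \<le> p * card {w \<in> V. Rel 0 u w}" if "u \<in> V" for u
      proof -
        have "1 / p * ?n \<le> c * ?n" using dc by (intro mult_right_mono) auto
        then have "1 / p * ?n \<le> card {w \<in> V. Rel 0 u w}" using close[OF that] by (rule order_trans)
        then have "real ?n \<le> real (p * card {w \<in> V. Rel 0 u w})" using p by (simp add: field_simps)
        then show ?thesis by (simp only: of_nat_le_iff)
      qed
      show "\<exists>u\<in>I. \<exists>v\<in>I. u \<noteq> v \<and> Rel 0 u v" if I: "I \<subseteq> V" "card I = p" for I
      proof -
        have "(2 * real p) * p < (\<gamma> * N0) * p" using N0g p by (intro mult_strict_right_mono) auto
        then have "1 + real p ^ 2 / N0 < p * c"
          using N0'(3) p by (simp add: c_def field_simps power2_eq_square)
        then have "\<exists>u\<in>I. \<exists>v\<in>I. u \<noteq> v \<and> ?n ^ (k - 1) \<le> N0 * card (?L u \<inter> ?L v)"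
          by (rule close_pair_exists[OF fV V I p _ N0'(3), rotated]) (rule link)
        then show ?thesis using Rel0 by blast
      qed
    qed
    then obtain A lab where A: "A \<subseteq> V" "card A < p" "\<And>u. u \<in> V \<Longrightarrow> lab u \<in> A"
      "\<And>u v. u \<in> V \<Longrightarrow> v \<in> V \<Longrightarrow> lab u = lab v \<Longrightarrow> Rel (2 * p + 3) u v"
      "\<And>a. a \<in> A \<Longrightarrow> M * card {w \<in> V. Rel 0 a w} \<le> M * card {u \<in> V. lab u = a} + p * card V"
      by blast
    have fA: "finite A" using A(1) fV finite_subset by blast
    have size: "(1 / p + \<gamma> / 4) * ?n \<le> card {u \<in> V. lab u = a}" if a: "a \<in> A" for a
    proof -
      have "real (M * card {w \<in> V. Rel 0 a w}) \<le> real (M * card {u \<in> V. lab u = a} + p * card V)"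
        using A(5)[OF a] by (rule of_nat_mono)
      moreover have "M * (c * ?n) \<le> M * real (card {w \<in> V. Rel 0 a w})"
        using close[of a] a A(1) by (intro mult_left_mono) auto
      moreover have "4 * real p * ?n \<le> \<gamma> * M * ?n" using Mg by (intro mult_right_mono) auto
      ultimately have "M * ((1 / p + \<gamma> / 4) * ?n) \<le> M * real (card {u \<in> V. lab u = a})"
        by (simp add: c_def algebra_simps)
      then show ?thesis using M'(3) by simp
    qed
    obtain h where h: "bij_betw h A {0..<card A}" using ex_bij_betw_finite_nat[OF fA] by blast
    have hinj: "inj_on h A" using h by (simp add: bij_betw_def)
    have him: "h ` A = {..<card A}" using h by (auto simp: bij_betw_def)
    have "0 < card A" using V A(3) fA card_gt_0_iff by blast
    moreover have "(h \<circ> lab) ` V \<subseteq> {..<card A}" using A(3) him by auto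
    moreover have "reach V E (Ns (2 * p + 3)) {#u#} {#v#}" if "u \<in> V" "v \<in> V" "(h \<circ> lab) u = (h \<circ> lab) v" for u v
      using A(4)[of u v] that A(3) hinj by (auto simp: Rel_def inj_on_def)
    moreover have "(1 / p + \<gamma> / 4) * ?n \<le> card {u \<in> V. (h \<circ> lab) u = j}" if "j < card A" for j
    proof -
      have "j \<in> h ` A" using that him by simp
      then obtain a where a: "a \<in> A" "j = h a" by blast
      have "h (lab u) = h a \<longleftrightarrow> lab u = a" if "u \<in> V" for u
        using inj_on_eq_iff[OF hinj A(3)[OF that] a(1)] .
      then have "{u \<in> V. (h \<circ> lab) u = j} = {u \<in> V. lab u = a}" using a(2) by auto
      then show ?thesis using size[OF a(1)] by simp
    qed
    ultimately show "\<exists>r (lab :: 'a \<Rightarrow> nat). 0 < r \<and> r < p \<and> lab ` V \<subseteq> {..<r} \<and>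
        (\<forall>u\<in>V. \<forall>v\<in>V. lab u = lab v \<longrightarrow> reach V E (Ns (2 * p + 3)) {#u#} {#v#}) \<and>
        (\<forall>j<r. (1 / p + \<gamma> / 4) * card V \<le> card {u \<in> V. lab u = j})"
      using A(2) by (intro exI[of _ "card A"] exI[of _ "h \<circ> lab"]) blast
  qed
qed

section \<open>Almost perfect and perfect tilings\<close>

text \<open>If the claim fails, hits from different indices coincide. Then either all hits are at
  one vertex or they all come from one index, and both give a sum of at most
  \<open>k\<close>.\<close>

lemma two_hits_if_sum_large:
  fixes f :: "nat \<Rightarrow> 'a set"
  assumes "finite e" "card e \<le> k" "k < (\<Sum>i<k. card (f i \<inter> e))"
  shows "\<exists>i<k. \<exists>j<k. \<exists>x y. i \<noteq> j \<and> x \<noteq> y \<and> x \<in> f i \<inter> e \<and> y \<in> f j \<inter> e"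
proof (rule ccontr)
  assume c: "\<not> ?thesis"
  then have eq: "x = y" if "i < k" "j < k" "i \<noteq> j" "x \<in> f i \<inter> e" "y \<in> f j \<inter> e" for i j x y
    using that by blast
  have le: "(\<Sum>i<k. card (f i \<inter> e)) \<le> k"
  proof (cases "\<exists>i<k. \<exists>j<k. i \<noteq> j \<and> f i \<inter> e \<noteq> {} \<and> f j \<inter> e \<noteq> {}")
    case True
    then obtain i j x y where ij: "i < k" "j < k" "i \<noteq> j" "x \<in> f i \<inter> e" "y \<in> f j \<inter> e" by blast
    have "z = x" if "l < k" "z \<in> f l \<inter> e" for l z
    proof (cases "l = i")
      case True
      then have "z = y" using eq[of i j z y] ij that by blast
      then show ?thesis using eq[of i j x y] ij by blast
    next
      case False
      then show ?thesis using eq[of i l x z] ij that by blast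
    qed
    then have "f l \<inter> e \<subseteq> {x}" if "l < k" for l using that by blast
    then have "card (f l \<inter> e) \<le> 1" if "l < k" for l
      using that card_mono[of "{x}" "f l \<inter> e"] by simp
    then have "(\<Sum>i<k. card (f i \<inter> e)) \<le> (\<Sum>i<k. 1)" by (intro sum_mono) simp
    then show ?thesis by simp
  next
    case False
    show ?thesis
    proof (cases "\<exists>i<k. f i \<inter> e \<noteq> {}")
      case True
      then obtain i where i: "i < k" "f i \<inter> e \<noteq> {}" by blast
      have "f j \<inter> e = {}" if "j < k" "j \<noteq> i" for j using False i that by blast
      then have "(\<Sum>i<k. card (f i \<inter> e)) = (\<Sum>j<k. if j = i then card (f i \<inter> e) else 0)"
        by (intro sum.cong) auto
      also have "\<dots> = card (f i \<inter> e)" using i by simp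
      also have "\<dots> \<le> k" using assms card_mono[of e "f i \<inter> e"] by simp
      finally show ?thesis .
    next
      case False
      then show ?thesis by simp
    qed
  qed
  then show False using assms(3) by simp
qed

lemma obtain_disjoint_subsets:
  assumes "finite U" "m * s \<le> card U"
  shows "\<exists>S. (\<forall>i<m. S i \<subseteq> U \<and> card (S i) = s) \<and> (\<forall>i<m. \<forall>j<m. i \<noteq> j \<longrightarrow> S i \<inter> S j = {})"
  using assms
proof (induction m arbitrary: U)
  case (Suc m)
  obtain T where T: "T \<subseteq> U" "card T = s"
    using Suc.prems obtain_subset_with_card_n[of s U] by auto
  have "m * s \<le> card (U - T)"
    using Suc.prems T by (simp add: card_Diff_subset finite_subset)
  then obtain S where S: "\<forall>i<m. S i \<subseteq> U - T \<and> card (S i) = s"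
    "\<forall>i<m. \<forall>j<m. i \<noteq> j \<longrightarrow> S i \<inter> S j = {}"
    using Suc.IH[of "U - T"] Suc.prems(1) by auto
  have "S i \<inter> T = {}" if "i < m" for i using S(1) that by blast
  then show ?case using S T
    by (intro exI[of _ "S(m := T)"]) (auto simp: less_Suc_eq)
qed simp

text \<open>A maximum matching is improved by trading one of its edges for two: among \<open>k\<close> disjoint
  \<open>(k - 1)\<close>-sets of uncovered vertices, averaging gives a matching edge that receives more than
  \<open>k\<close> neighbours.\<close>

lemma almost_perfect_matching:
  assumes H: "uniform_hypergraph k V E" and k: "2 \<le> k" and V': "V' \<subseteq> V"
    and deg: "\<And>S. S \<subseteq> V' \<Longrightarrow> card S = k - 1 \<Longrightarrow> card V' < k * card {v \<in> V'. insert v S \<in> E}"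
  shows "\<exists>M. M \<subseteq> E \<and> pairwise disjnt M \<and> \<Union>M \<subseteq> V' \<and> card (V' - \<Union>M) < k * (k - 1)"
proof -
  define P where "P M \<longleftrightarrow> M \<subseteq> E \<and> pairwise disjnt M \<and> \<Union>M \<subseteq> V'" for M
  have finV: "finite V" using H by (simp add: uniform_hypergraph_def)
  have finV': "finite V'" using V' finV finite_subset by blast
  have finE: "finite E" using H finite_subset[OF _ finite_imp_finite_nsets[OF finV]]
    unfolding uniform_hypergraph_def by blast
  have finP: "finite (Collect P)"
    by (rule finite_subset[of _ "Pow E"]) (use finE in \<open>auto simp: P_def\<close>)
  have "P {}" by (simp add: P_def)
  then have "Max (card ` Collect P) \<in> card ` Collect P" using finP by (intro Max_in) auto
  then obtain M where PM: "P M" "card M = Max (card ` Collect P)" by auto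
  have max: "card M' \<le> card M" if "P M'" for M'
    unfolding PM(2) using that finP by (intro Max_ge) auto
  have M: "M \<subseteq> E" "pairwise disjnt M" "\<Union>M \<subseteq> V'" using PM(1) by (auto simp: P_def)
  have finM: "finite M" using M finE finite_subset by blast
  have edge: "finite e" "card e = k" if "e \<in> E" for e using uniform_hypergraph_edge[OF H that] by auto
  show ?thesis
  proof (rule ccontr)
    assume c: "\<not> ?thesis"
    have "k * (k - 1) \<le> card (V' - \<Union>M)"
    proof (rule ccontr)
      assume "\<not> k * (k - 1) \<le> card (V' - \<Union>M)"
      then have "card (V' - \<Union>M) < k * (k - 1)" by simp
      with M c show False by blast
    qed
    from obtain_disjoint_subsets[OF finite_Diff[OF finV'] this]
    obtain S where "\<forall>i<k. S i \<subseteq> V' - \<Union>M \<and> card (S i) = k - 1"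
      "\<forall>i<k. \<forall>j<k. i \<noteq> j \<longrightarrow> S i \<inter> S j = {}" by (elim exE conjE)
    then have S: "\<And>i. i < k \<Longrightarrow> S i \<subseteq> V' - \<Union>M" "\<And>i. i < k \<Longrightarrow> card (S i) = k - 1"
      "\<And>i j. i < k \<Longrightarrow> j < k \<Longrightarrow> i \<noteq> j \<Longrightarrow> S i \<inter> S j = {}" by simp_all
    have finS: "finite (S i)" if "i < k" for i using S(1)[OF that] finV' by (meson finite_Diff finite_subset)
    define N where "N i = {v \<in> V'. insert v (S i) \<in> E}" for i
    have notin: "v \<notin> S i" if "i < k" "v \<in> N i" for i v
    proof
      assume "v \<in> S i"
      then have "insert v (S i) = S i" by blast
      then show False using that S(2) edge(2)[of "S i"] k by (simp add: N_def)
    qed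
    \<comment> \<open>An uncovered neighbour would complete \<open>S i\<close> to an edge disjoint
      from \<open>M\<close>, against maximality.\<close>
    have N_sub: "N i \<subseteq> \<Union>M" if i: "i < k" for i
    proof (rule ccontr)
      assume "\<not> ?thesis"
      then obtain v where v: "v \<in> N i" "v \<notin> \<Union>M" by blast
      let ?e = "insert v (S i)"
      have dis: "\<forall>e\<in>M. disjnt ?e e" using v S(1)[OF i] by (auto simp: disjnt_def)
      have "?e \<notin> M" using v by blast
      moreover have "P (insert ?e M)" using M v S(1)[OF i] dis unfolding P_def
        by (auto simp: N_def pairwise_insert disjnt_sym)
      ultimately show False using max[of "insert ?e M"] finM by simp
    qed
    have cardU: "card (\<Union>M) = k * card M"
      using M edge finM by (subst card_Union_disjoint) (auto simp: subset_eq)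
    have "card (N i) = (\<Sum>e\<in>M. card (N i \<inter> e))" if i: "i < k" for i
    proof -
      have "N i = (\<Union>e\<in>M. N i \<inter> e)" using N_sub[OF i] by auto
      then have "card (N i) = card (\<Union>e\<in>M. N i \<inter> e)" by simp
      also have "\<dots> = (\<Sum>e\<in>M. card (N i \<inter> e))"
        using finM M edge by (intro card_UN_disjoint) (auto simp: pairwise_def disjnt_def)
      finally show ?thesis .
    qed
    then have swap: "(\<Sum>i<k. card (N i)) = (\<Sum>e\<in>M. \<Sum>i<k. card (N i \<inter> e))"
      by (simp add: sum.swap[of _ M])
    have degN: "card V' < k * card (N i)" if i: "i < k" for i
      unfolding N_def using S(1)[OF i] by (intro deg S(2)[OF i]) blast
    have "k * card V' = (\<Sum>i<k. card V')" by simp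
    also have "\<dots> < (\<Sum>i<k. k * card (N i))"
      using degN k by (intro sum_strict_mono) (auto simp: lessThan_empty_iff)
    also have "\<dots> = k * (\<Sum>i<k. card (N i))" by (simp add: sum_distrib_left)
    finally have "card V' < (\<Sum>i<k. card (N i))" by simp
    moreover have "k * card M \<le> card V'" using card_mono[OF finV' M(3)] cardU by simp
    ultimately have "k * card M < (\<Sum>e\<in>M. \<Sum>i<k. card (N i \<inter> e))" using swap by simp
    then have "\<exists>e\<in>M. k < (\<Sum>i<k. card (N i \<inter> e))"
      using sum_bounded_above[of M "\<lambda>e. \<Sum>i<k. card (N i \<inter> e)" k] by (force simp: mult.commute)
    then obtain e where e: "e \<in> M" "k < (\<Sum>i<k. card (N i \<inter> e))" by blast
    have eE: "e \<in> E" using e M by blast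
    obtain i j x y where ij: "i < k" "j < k" "i \<noteq> j" "x \<noteq> y" "x \<in> N i \<inter> e" "y \<in> N j \<inter> e"
      using two_hits_if_sum_large[of e k N] edge[OF eE] e(2) by auto
    let ?a = "insert x (S i)" and ?b = "insert y (S j)"
    have dMe: "\<forall>f\<in>M - {e}. disjnt e f" using M(2) e by (auto simp: pairwise_def)
    have xM: "x \<in> \<Union>M" "y \<in> \<Union>M" using ij e by auto
    have dis_a: "\<forall>f\<in>M - {e}. disjnt ?a f" and dis_b: "\<forall>f\<in>M - {e}. disjnt ?b f"
      using dMe ij S(1)[OF ij(1)] S(1)[OF ij(2)] by (auto simp: disjnt_def)
    have dis_ab: "disjnt ?a ?b"
      using S(3)[OF ij(1-3)] ij S(1)[OF ij(1)] S(1)[OF ij(2)] xM by (auto simp: disjnt_def)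
    have dis_a': "\<forall>f\<in>M - {e}. disjnt f ?a" and dis_b': "\<forall>f\<in>M - {e}. disjnt f ?b"
      and dis_ab': "disjnt ?b ?a"
      using dis_a dis_b dis_ab by (blast intro: disjnt_sym)+
    have a: "?a \<noteq> ?b" "?a \<notin> M - {e}" "?b \<notin> M - {e}"
      using dis_ab dis_a dis_b by (auto simp: disjnt_def)
    have "P (insert ?a (insert ?b (M - {e})))" unfolding P_def
    proof (intro conjI)
      show "insert ?a (insert ?b (M - {e})) \<subseteq> E" using ij M by (auto simp: N_def)
      have "pairwise disjnt (M - {e})" using M(2) by (rule pairwise_subset) blast
      then show "pairwise disjnt (insert ?a (insert ?b (M - {e})))"
        using dis_a dis_b dis_ab dis_a' dis_b' dis_ab'
        by (auto simp: pairwise_insert simp del: disjnt_insert1 disjnt_insert2)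
      show "\<Union>(insert ?a (insert ?b (M - {e}))) \<subseteq> V'"
        using M(3) ij S(1)[OF ij(1)] S(1)[OF ij(2)] by (auto simp: N_def)
    qed
    then have "card (insert ?a (insert ?b (M - {e}))) \<le> card M" by (rule max)
    moreover have "card (insert ?a (insert ?b (M - {e}))) = Suc (Suc (card (M - {e})))"
      using a finM by simp
    moreover have "Suc (card (M - {e})) = card M" using finM e by (intro card_Suc_Diff1) auto
    ultimately show False by simp
  qed
qed

section \<open>Reserved edges and assembly of the tiling\<close>

lemma mset_set_Union_disjoint:
  assumes "finite F" "pairwise disjnt F" "\<And>e. e \<in> F \<Longrightarrow> finite e"
  shows "mset_set (\<Union>F) = (\<Sum>e\<in>F. mset_set e)"
  using assms
proof (induction F rule: finite_induct)
  case (insert e F)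
  have "e \<inter> \<Union>F = {}" using insert by (auto simp: pairwise_insert disjnt_def)
  then have "mset_set (e \<union> \<Union>F) = mset_set e + mset_set (\<Union>F)"
    using insert by (intro mset_set_Union) auto
  then show ?case using insert by (simp add: pairwise_insert)
qed simp

lemma tileable_Union:
  assumes "finite F" "pairwise disjnt F" "F \<subseteq> E" "\<And>e. e \<in> E \<Longrightarrow> finite e"
  shows "tileable E (mset_set (\<Union>F))"
proof -
  have "mset_set (\<Union>F) = (\<Sum>e\<in>F. mset_set e)"
    using assms by (intro mset_set_Union_disjoint) auto
  then show ?thesis using assms(3) by (auto intro: tileable_sum tileable_edge)
qed

text \<open>Greedy choice: the edges already chosen occupy at most \<open>K * k\<close> vertices, so
  the rest of \<open>X\<close> still contains an edge.\<close>

lemma disjoint_edges_exist: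
  assumes H: "uniform_hypergraph k V E" and k: "0 < k" and X: "finite X"
    and dense: "\<And>Y. Y \<subseteq> X \<Longrightarrow> card X \<le> card Y + K * k \<Longrightarrow> \<exists>e\<in>E. e \<subseteq> Y"
  shows "\<exists>F\<subseteq>E. pairwise disjnt F \<and> finite F \<and> card F = K \<and> \<Union>F \<subseteq> X"
  using dense
proof (induction K)
  case 0
  then show ?case by (intro exI[of _ "{}"]) auto
next
  case (Suc K)
  have "\<exists>F\<subseteq>E. pairwise disjnt F \<and> finite F \<and> card F = K \<and> \<Union>F \<subseteq> X"
    by (rule Suc.IH) (rule Suc.prems, auto)
  then obtain F where F: "F \<subseteq> E" "pairwise disjnt F" "finite F" "card F = K" "\<Union>F \<subseteq> X" by blast
  have fin: "finite (\<Union>F)" using F(5) X finite_subset by blast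
  have "card (\<Union>F) \<le> (\<Sum>e\<in>F. card e)" by (rule card_Union_le_sum_card)
  also have "\<dots> = (\<Sum>e\<in>F. k)" using F(1) uniform_hypergraph_edge(3)[OF H] by (intro sum.cong) auto
  also have "\<dots> = K * k" using F(4) by simp
  finally have "card X \<le> card (X - \<Union>F) + Suc K * k"
    using card_Diff_subset[OF fin F(5)] by simp
  then obtain e where e: "e \<in> E" "e \<subseteq> X - \<Union>F" using Suc.prems[of "X - \<Union>F"] by blast
  have "e \<noteq> {}" using uniform_hypergraph_edge(3)[OF H e(1)] k by auto
  then have "e \<notin> F" using e(2) by blast
  have "\<forall>f\<in>F. disjnt e f \<and> disjnt f e" using e(2) by (auto simp: disjnt_def)
  then have "pairwise disjnt (insert e F)" using F(2) by (auto simp: pairwise_insert)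
  then show ?case using F e \<open>e \<notin> F\<close> by (intro exI[of _ "insert e F"]) auto
qed

lemma count_image_mset_set:
  assumes "finite U"
  shows "count (image_mset f (mset_set U)) j = card {u \<in> U. f u = j}"
proof -
  have "count (image_mset f (mset_set U)) j = (\<Sum>u\<in>f -` {j} \<inter> U. count (mset_set U) u)"
    using assms by (simp add: count_image_mset)
  also have "\<dots> = (\<Sum>u\<in>{u \<in> U. f u = j}. 1)" using assms by (intro sum.cong) auto
  finally show ?thesis by simp
qed

lemma image_mset_sum:
  "image_mset f (\<Sum>i\<in>I. g i) = (\<Sum>i\<in>I. image_mset f (g i))"
  by (induction I rule: infinite_finite_induct) auto

text \<open>If \<open>c j\<close> uncovered vertices are labelled \<open>j\<close>, then
  \<open>t * c j\<close> reserved edges of part \<open>j\<close> are given up. They contribute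
  \<open>k * t * c j\<close> further vertices labelled \<open>j\<close>, so \<open>U\<close> and
  these edges together have index vector \<open>1 + k * t\<close> times that of \<open>U\<close>,
  and \<open>W\<close> absorbs them. The other reserved edges remain in the tiling.\<close>

lemma tileable_from_absorber:
  fixes lab :: "'a \<Rightarrow> nat"
  assumes H: "uniform_hypergraph k V E" and k: "0 < k" "k dvd card V"
    and lab: "lab ` V \<subseteq> {..<r}" and W: "W \<subseteq> V" "tileable E (mset_set W)"
    and F: "\<And>j. j < r \<Longrightarrow> F j \<subseteq> E" "\<And>j. j < r \<Longrightarrow> pairwise disjnt (F j)"
      "\<And>j. j < r \<Longrightarrow> card (F j) = K" "\<And>j. j < r \<Longrightarrow> \<Union>(F j) \<subseteq> {u \<in> V - W. lab u = j}"
    and M: "M \<subseteq> E" "pairwise disjnt M" "\<Union>M \<subseteq> V - W - (\<Union>j<r. \<Union>(F j))"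
    and U: "U = V - W - (\<Union>j<r. \<Union>(F j)) - \<Union>M" "t * card U \<le> K"
    and good: "\<And>x. set_mset x \<subseteq> {..<r} \<Longrightarrow> k dvd size x \<Longrightarrow> good R (repeat_mset (1 + k * t) x)"
    and absorb: "\<And>D. D \<subseteq> V - W \<Longrightarrow> card D \<le> (1 + k * t) * card U \<Longrightarrow>
       good R (image_mset lab (mset_set D)) \<Longrightarrow> tileable E (mset_set (W \<union> D))"
  shows "tileable E (mset_set V)"
proof -
  have fV: "finite V" using H by (simp add: uniform_hypergraph_def)
  have edge: "finite e" "card e = k" if "e \<in> E" for e using uniform_hypergraph_edge[OF H that] by auto
  have fE: "finite E" using H finite_subset[OF _ finite_imp_finite_nsets[OF fV]]
    unfolding uniform_hypergraph_def by blast
  have fU: "finite U" using U(1) fV by simp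
  have fF: "finite (F j)" if "j < r" for j using F(1)[OF that] fE finite_subset by blast
  define c where "c j = card {u \<in> U. lab u = j}" for j
  have "\<exists>G. G \<subseteq> F j \<and> card G = t * c j" if j: "j < r" for j
  proof -
    have "c j \<le> card U" unfolding c_def using fU by (intro card_mono) auto
    then have "t * c j \<le> card (F j)" using U(2) F(3)[OF j] by (metis le_trans mult_le_mono2)
    then show ?thesis by (metis obtain_subset_with_card_n)
  qed
  then obtain G where G: "\<And>j. j < r \<Longrightarrow> G j \<subseteq> F j" "\<And>j. j < r \<Longrightarrow> card (G j) = t * c j" by metis
  define FF where "FF = (\<Union>j<r. F j)"
  define GG where "GG = (\<Union>j<r. G j)"
  have FFE: "FF \<subseteq> E" using F(1) by (auto simp: FF_def)
  have GF: "GG \<subseteq> FF" using G(1) by (auto simp: FF_def GG_def)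
  have fFF: "finite FF" using FFE fE finite_subset by blast
  have fGG: "finite GG" using GF fFF finite_subset by blast
  have dFF: "pairwise disjnt FF"
  proof (rule pairwiseI)
    fix e f assume ef: "e \<in> FF" "f \<in> FF" "e \<noteq> f"
    then obtain i j where ij: "i < r" "j < r" "e \<in> F i" "f \<in> F j" by (auto simp: FF_def)
    show "disjnt e f"
    proof (cases "i = j")
      case True
      then show ?thesis using F(2)[OF ij(1)] ij ef by (auto simp: pairwise_def)
    next
      case False
      then show ?thesis using F(4)[OF ij(1)] F(4)[OF ij(2)] ij unfolding disjnt_def by blast
    qed
  qed
  have UFF: "\<Union>FF = (\<Union>j<r. \<Union>(F j))" by (auto simp: FF_def)
  have FFV: "\<Union>FF \<subseteq> V - W" unfolding UFF using F(4) by blast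
  have fM: "finite M" using M(1) fE finite_subset by blast
  have tM: "tileable E (mset_set (\<Union>M))" using M edge fM by (intro tileable_Union) auto
  have tF: "tileable E (mset_set (\<Union>FF))" using FFE dFF edge fFF by (intro tileable_Union) auto
  have tFG: "tileable E (mset_set (\<Union>(FF - GG)))"
  proof (rule tileable_Union)
    show "pairwise disjnt (FF - GG)" by (rule pairwise_subset[OF dFF]) blast
  qed (use FFE edge fFF in auto)
  have fW: "finite W" using W fV finite_subset by blast
  have fUM: "finite (\<Union>M)" using M(3) fV by (meson finite_Diff finite_subset)
  have fUF: "finite (\<Union>FF)" using FFV fV by (meson finite_Diff finite_subset)
  have card_t: "k dvd card X" if "tileable E (mset_set X)" for X
    using size_tileable[OF that, of k] edge by simp
  \<comment> \<open>Counted in order to get \<open>k dvd card U\<close>, the size condition required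
    by \<open>good\<close>: all other pieces are tileable.\<close>
  have "card V = card W + (card (\<Union>FF) + (card (\<Union>M) + card U))"
  proof -
    have "V = W \<union> (\<Union>FF \<union> (\<Union>M \<union> U))" using U(1) W(1) M(3) FFV UFF by blast
    moreover have "card (\<Union>M \<union> U) = card (\<Union>M) + card U"
      using U(1) fUM fU by (intro card_Un_disjoint) auto
    moreover have "card (\<Union>FF \<union> (\<Union>M \<union> U)) = card (\<Union>FF) + card (\<Union>M \<union> U)"
      using U(1) M(3) UFF fUM fU fUF by (intro card_Un_disjoint) auto
    moreover have "card (W \<union> (\<Union>FF \<union> (\<Union>M \<union> U))) = card W + card (\<Union>FF \<union> (\<Union>M \<union> U))"
      using U(1) M(3) FFV fUM fU fUF fW by (intro card_Un_disjoint) auto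
    ultimately show ?thesis by simp
  qed
  then have kU: "k dvd card U"
    using k(2) card_t[OF W(2)] card_t[OF tF] card_t[OF tM] by (metis dvd_add_right_iff)
  define x where "x = image_mset lab (mset_set U)"
  have xr: "set_mset x \<subseteq> {..<r}"
    using lab U(1) fU by (auto simp: x_def)
  have cx: "count x j = c j" for j
    unfolding x_def c_def using fU by (rule count_image_mset_set)
  let ?Q = "\<Union>GG"
  have QF: "?Q \<subseteq> \<Union>FF" using GF by blast
  have fQ: "finite ?Q" using QF fUF finite_subset by blast
  have dGG: "pairwise disjnt GG" using dFF GF by (rule pairwise_subset)
  have labQ: "image_mset lab (mset_set ?Q) = repeat_mset (k * t) x"
  proof -
    have "mset_set ?Q = (\<Sum>e\<in>GG. mset_set e)"
      using fGG dGG GF FFE edge by (intro mset_set_Union_disjoint) auto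
    also have "\<dots> = (\<Sum>j<r. \<Sum>e\<in>G j. mset_set e)"
      unfolding GG_def
    proof (rule sum.UNION_disjoint)
      show "\<forall>j\<in>{..<r}. finite (G j)" using G(1) fF finite_subset by blast
      show "\<forall>i\<in>{..<r}. \<forall>j\<in>{..<r}. i \<noteq> j \<longrightarrow> G i \<inter> G j = {}"
      proof (intro ballI impI)
        fix i j assume ij: "i \<in> {..<r}" "j \<in> {..<r}" "i \<noteq> j"
        have "False" if e: "e \<in> G i" "e \<in> G j" for e
        proof -
          have ee: "e \<in> F i" "e \<in> F j" using e G(1) ij by blast+
          then have "e \<in> E" using F(1) ij by blast
          then have "e \<noteq> {}" using edge(2) k by fastforce
          then show False using ee F(4)[of i] F(4)[of j] ij by blast
        qed
        then show "G i \<inter> G j = {}" by blast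
      qed
    qed simp
    finally have "image_mset lab (mset_set ?Q) = (\<Sum>j<r. \<Sum>e\<in>G j. image_mset lab (mset_set e))"
      by (simp add: image_mset_sum)
    also have "\<dots> = (\<Sum>j<r. \<Sum>e\<in>G j. replicate_mset k j)"
    proof (intro sum.cong refl)
      fix j e assume je: "j \<in> {..<r}" "e \<in> G j"
      then have e: "e \<in> F j" "e \<in> E" using G(1) F(1) by blast+
      then have "lab u = j" if "u \<in> e" for u using F(4)[of j] je that by blast
      then have "image_mset lab (mset_set e) = image_mset (\<lambda>_. j) (mset_set e)"
        using edge(1)[OF e(2)] by (intro image_mset_cong) auto
      then show "image_mset lab (mset_set e) = replicate_mset k j"
        using edge[OF e(2)] by (simp add: image_mset_const_eq)
    qed
    also have "\<dots> = (\<Sum>j<r. repeat_mset (card (G j)) (replicate_mset k j))"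
      by (simp only: sum_constant_mset)
    also have "\<dots> = repeat_mset (k * t) x"
    proof (rule multiset_eqI)
      fix a
      have "count (\<Sum>j<r. repeat_mset (card (G j)) (replicate_mset k j)) a =
          (\<Sum>j<r. if j = a then card (G j) * k else 0)"
        unfolding count_sum by (intro sum.cong) auto
      also have "\<dots> = (if a < r then t * c a * k else 0)" using G(2) by simp
      also have "\<dots> = k * t * count x a"
      proof (cases "a < r")
        case False
        then have "a \<notin># x" using xr by auto
        then show ?thesis using False by (simp add: not_in_iff)
      qed (simp add: cx)
      finally show "count (\<Sum>j<r. repeat_mset (card (G j)) (replicate_mset k j)) a =
          count (repeat_mset (k * t) x) a" by simp
    qed
    finally show ?thesis .
  qed
  have disUQ: "U \<inter> ?Q = {}" using U(1) QF UFF by blast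
  let ?D = "U \<union> ?Q"
  have mD: "mset_set ?D = mset_set U + mset_set ?Q" using fU fQ disUQ by (intro mset_set_Union)
  have labD: "image_mset lab (mset_set ?D) = repeat_mset (1 + k * t) x"
    unfolding mD by (simp add: labQ x_def)
  have "card ?D = size (image_mset lab (mset_set ?D))" by simp
  also have "\<dots> = (1 + k * t) * card U" unfolding labD by (simp add: x_def)
  finally have cD: "card ?D \<le> (1 + k * t) * card U" by simp
  have tD: "tileable E (mset_set (W \<union> ?D))"
  proof (rule absorb[OF _ cD])
    show "?D \<subseteq> V - W" using U(1) QF FFV by blast
    show "good R (image_mset lab (mset_set ?D))"
      unfolding labD using xr kU by (intro good) (auto simp: x_def)
  qed
  have eqFG: "\<Union>(FF - GG) = \<Union>FF - ?Q"
  proof -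
    have "u \<notin> f" if "e \<in> FF - GG" "u \<in> e" "f \<in> GG" for e f u
    proof -
      have "e \<in> FF" "f \<in> FF" "e \<noteq> f" using that GF by blast+
      then have "disjnt e f" using dFF by (simp add: pairwise_def)
      then show ?thesis using that(2) by (auto simp: disjnt_def)
    qed
    then show ?thesis by blast
  qed
  have split: "V = (W \<union> (U \<union> Q)) \<union> ((Z - Q) \<union> X)" "(W \<union> (U \<union> Q)) \<inter> ((Z - Q) \<union> X) = {}" "(Z - Q) \<inter> X = {}"
    if "U = V - W - Z - X" "X \<subseteq> V - W - Z" "Z \<subseteq> V - W" "Q \<subseteq> Z" for Z X Q
    using that W(1) by blast+
  have UV: "U = V - W - \<Union>FF - \<Union>M" and MV: "\<Union>M \<subseteq> V - W - \<Union>FF"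
    using U(1) M(3) unfolding UFF .
  have fR: "finite (\<Union>FF - ?Q)" using fUF by simp
  have "mset_set V = mset_set ((W \<union> ?D) \<union> (\<Union>(FF - GG) \<union> \<Union>M))"
    unfolding eqFG by (rule arg_cong[OF split(1)[OF UV MV FFV QF]])
  also have "\<dots> = mset_set (W \<union> ?D) + mset_set (\<Union>(FF - GG) \<union> \<Union>M)"
    unfolding eqFG using fW fU fQ fR fUM
    by (intro mset_set_Union split(2)[OF UV MV FFV QF] finite_UnI)
  also have "mset_set (\<Union>(FF - GG) \<union> \<Union>M) = mset_set (\<Union>(FF - GG)) + mset_set (\<Union>M)"
    unfolding eqFG using fR fUM by (intro mset_set_Union split(3)[OF UV MV FFV QF])
  finally show ?thesis using tD tFG tM by (simp only: tileable_add)
qed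

section \<open>Translation of the hypotheses and conclusion\<close>

lemma prime_factor_Min:
  fixes k :: nat
  assumes "2 \<le> k" "p = Min (prime_factors k)"
  shows "2 \<le> p" "p \<le> k" "\<And>q. 0 < q \<Longrightarrow> q < p \<Longrightarrow> coprime q k"
proof -
  have "\<exists>q. prime q \<and> q dvd k" using assms(1) by (intro prime_factor_nat) simp
  then have "prime_factors k \<noteq> {}" using assms(1) by (auto simp: prime_factors_dvd)
  then have "p \<in> prime_factors k" unfolding assms(2) by (intro Min_in) auto
  then have p: "prime p" "p dvd k" by auto
  then show "2 \<le> p" "p \<le> k" using assms(1) by (auto simp: prime_ge_2_nat dvd_imp_le)
  show "coprime q k" if q: "0 < q" "q < p" for q
  proof (rule ccontr)
    assume "\<not> coprime q k"
    then have "gcd q k \<noteq> 1" by (simp add: coprime_iff_gcd_eq_1)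
    then obtain s where s: "prime s" "s dvd gcd q k" using prime_factor_nat by blast
    then have "s \<in> prime_factors k" using assms(1) by (auto simp: prime_factors_dvd)
    then have "p \<le> s" unfolding assms(2) by (intro Min_le) auto
    moreover have "s \<le> q" using s q(1) by (intro dvd_imp_le) auto
    ultimately show False using q by simp
  qed
qed

lemma contains_edge_if_card_gt:
  assumes "finite V" "real (independence_number V E) \<le> a" "Y \<subseteq> V" "a < card Y"
  shows "\<exists>e\<in>E. e \<subseteq> Y"
proof (rule ccontr)
  assume "\<not> ?thesis"
  then have "independent_set V E Y" using assms(3) by (auto simp: independent_set_def)
  moreover have "finite {S. independent_set V E S}"
    by (rule finite_subset[of _ "Pow V"]) (use assms(1) in \<open>auto simp: independent_set_def\<close>)
  ultimately have "card Y \<le> independence_number V E"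
    unfolding independence_number_def by (intro Max_ge) auto
  then show False using assms by linarith
qed

lemma min_hdegree_le:
  assumes "finite V" "S \<subseteq> V" "card S = d"
  shows "min_hdegree d V E \<le> card {x \<in> V. insert x S \<in> E}"
proof -
  have "S \<in> nsets V d" using assms finite_subset by (auto simp: nsets_def)
  then have "min_hdegree d V E \<le> hdegree V E S"
    unfolding min_hdegree_def using finite_imp_finite_nsets[OF assms(1)] by (intro Min_le) auto
  then show ?thesis by (simp add: hdegree_def)
qed

theorem theorem1p2:
  fixes k :: nat and \<gamma> :: real
  assumes "k \<ge> 3" and "\<gamma> > 0"
  shows "\<exists>n0::nat. \<forall>n\<ge>n0. k dvd n \<longrightarrow>
    (\<forall>p. p = Min (prime_factors k) \<longrightarrow>
      (\<forall>(V :: 'a set) E.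
        uniform_hypergraph k V E \<and> card V = n \<and>
        real (independence_number V E) \<le> real n / real p \<and>
        real (min_hdegree (k - 1) V E) \<ge> (1 / real p + \<gamma>) * real n
        \<longrightarrow> (\<exists>M. perfect_matching V E M)))"
proof -
  define p where "p = Min (prime_factors k)"
  have k2: "2 \<le> k" using assms by simp
  have p: "2 \<le> p" "p \<le> k" "\<And>q. 0 < q \<Longrightarrow> q < p \<Longrightarrow> coprime q k"
    using prime_factor_Min[OF k2 p_def] by auto
  have p0: "0 < p" using p by simp
  obtain N1 n1 where part: "\<forall>(V :: 'a set) E. uniform_hypergraph k V E \<longrightarrow> n1 \<le> card V \<longrightarrow>
     (\<forall>S. S \<subseteq> V \<longrightarrow> card S = k - 1 \<longrightarrow> (1 / p + \<gamma>) * card V \<le> card {x \<in> V. insert x S \<in> E}) \<longrightarrow>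
     (\<exists>r (lab :: 'a \<Rightarrow> nat). 0 < r \<and> r < p \<and> lab ` V \<subseteq> {..<r} \<and>
        (\<forall>u\<in>V. \<forall>v\<in>V. lab u = lab v \<longrightarrow> reach V E N1 {#u#} {#v#}) \<and>
        (\<forall>j<r. (1 / p + \<gamma> / 4) * card V \<le> card {u \<in> V. lab u = j}))"
    using hypergraph_partition[OF k2 p0 assms(2)] by (elim exE)
  define N where "N = max N1 (2 * p ^ (k + 1))"
  \<comment> \<open>\<open>C\<close> and \<open>K\<close> bound \<open>(1 + k * t) * card U\<close>
    and \<open>t * card U\<close> for an uncovered set with fewer than \<open>k * (k - 1)\<close>
    vertices. The multiplier \<open>t\<close> is known only once the hypergraph is given, so
    \<open>p\<close> stands in for it.\<close>
  define C where "C = (1 + k * p) * (k * (k - 1))"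
  define K where "K = p * (k * (k - 1))"
  obtain N2 where N2: "\<forall>R V E lab S. R \<subseteq> {x. set_mset x \<subseteq> {..<p} \<and> size x \<le> k} \<longrightarrow>
      labelled k N R (V :: 'a set) E lab \<longrightarrow> set_mset S \<subseteq> V \<longrightarrow> lab ` V \<subseteq> {..<p} \<longrightarrow> size S \<le> C \<longrightarrow>
      good R (image_mset lab S) \<longrightarrow> reach V E N2 S {#}"
    using absorbable_uniform[of "{..<p}" k N C] by auto
  \<comment> \<open>\<open>L\<close> keeps the absorbing set below \<open>\<gamma> / 8 * n\<close>;
    \<open>n3\<close> does the same for the reserved edges.\<close>
  obtain L where L: "8 / \<gamma> < real L" using reals_Archimedean2 by blast
  have "0 < 8 / \<gamma>" using assms(2) by simp
  then have L0: "0 < L" using L by (metis less_trans of_nat_0_less_iff)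
  obtain n2 where n2: "\<forall>(V :: 'a set) E. finite V \<longrightarrow> n2 \<le> card V \<longrightarrow>
     (\<exists>W\<subseteq>V. L * card W \<le> card V \<and> tileable E (mset_set W) \<and>
        (\<forall>D. D \<subseteq> V - W \<longrightarrow> card D \<le> C \<longrightarrow> reach V E (N2 + 1) (mset_set D) {#} \<longrightarrow>
           tileable E (mset_set (W \<union> D))))"
    using absorbing_set[of "N2 + 1" L C] L0 by auto
  obtain n3 where n3: "8 * real (p * (K * k)) / \<gamma> < real n3" using reals_Archimedean2 by blast
  show ?thesis
  proof (intro exI[of _ "n1 + n2 + n3 + 2 * p ^ k * (k * k)"] allI impI)
    fix n p' :: nat and V :: "'a set" and E
    assume n: "n1 + n2 + n3 + 2 * p ^ k * (k * k) \<le> n" and kn: "k dvd n"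
      and p': "p' = Min (prime_factors k)"
      and VE: "uniform_hypergraph k V E \<and> card V = n \<and>
        real (independence_number V E) \<le> real n / real p' \<and>
        real (min_hdegree (k - 1) V E) \<ge> (1 / real p' + \<gamma>) * real n"
    have pp: "p' = p" by (simp add: p' p_def)
    have H: "uniform_hypergraph k V E" and cV: "card V = n"
      and \<alpha>: "real (independence_number V E) \<le> real n / real p"
      and \<delta>: "(1 / real p + \<gamma>) * real n \<le> real (min_hdegree (k - 1) V E)"
      using VE pp by auto
    have fV: "finite V" using H by (simp add: uniform_hypergraph_def)
    have large: "8 * real (p * (K * k)) < \<gamma> * n"
    proof -
      have "8 * real (p * (K * k)) / \<gamma> < real n" using n3 n by linarith
      then show ?thesis using assms(2) by (simp add: field_simps)
    qed
    have "0 \<le> 8 * real (p * (K * k))" by simp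
    then have "0 < \<gamma> * n" using large by linarith
    then have n0: "0 < n" using assms(2) by (simp add: zero_less_mult_iff)
    have Vne: "V \<noteq> {}" using cV n0 by auto
    have deg: "(1 / p + \<gamma>) * card V \<le> card {x \<in> V. insert x S \<in> E}" if "S \<subseteq> V" "card S = k - 1" for S
      using \<delta> min_hdegree_le[OF fV that, of E] unfolding cV by linarith
    have p_le: "card V \<le> p * m" if "(1 / p + g) * card V \<le> real m" "0 \<le> g" for g m
    proof -
      have "1 / p * card V \<le> (1 / p + g) * card V" using that(2) by (intro mult_right_mono) auto
      then have "1 / p * card V \<le> real m" using that(1) by linarith
      then have "real (card V) \<le> real (p * m)" using p0 by (simp add: field_simps)
      then show ?thesis by (simp only: of_nat_le_iff)
    qed
    have "\<exists>r (lab :: 'a \<Rightarrow> nat). 0 < r \<and> r < p \<and> lab ` V \<subseteq> {..<r} \<and>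
        (\<forall>u\<in>V. \<forall>v\<in>V. lab u = lab v \<longrightarrow> reach V E N1 {#u#} {#v#}) \<and>
        (\<forall>j<r. (1 / p + \<gamma> / 4) * card V \<le> card {u \<in> V. lab u = j})"
    proof (rule part[THEN spec, THEN spec, THEN mp, THEN mp, THEN mp, OF H])
      show "n1 \<le> card V" using n cV by simp
    qed (use deg in blast)
    then obtain r and lab :: "'a \<Rightarrow> nat" where r: "0 < r" "r < p" and lab: "lab ` V \<subseteq> {..<r}"
      and labreach: "\<forall>u\<in>V. \<forall>v\<in>V. lab u = lab v \<longrightarrow> reach V E N1 {#u#} {#v#}"
      and parts: "\<forall>j<r. (1 / p + \<gamma> / 4) * card V \<le> card {u \<in> V. lab u = j}" by (elim exE conjE)
    define cnt where "cnt v = card {w \<in> vlists V k. tileable E (mset w) \<and> image_mset lab (mset w) = v}" for v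
    \<comment> \<open>Labels range below \<open>p\<close>, not \<open>r\<close>, because
      \<open>N2\<close> was fixed before \<open>r\<close> was known.\<close>
    define R where "R = {v. set_mset v \<subseteq> {..<p} \<and> size v \<le> k \<and> card V ^ k \<le> N * cnt v}"
    have labelled: "labelled k N R V E lab"
      using fV labreach reach_mono[of V E N1 _ _ N] unfolding labelled_def R_def cnt_def N_def by auto
    have ext: "\<exists>j<r. good R (add_mset j w)" if w: "size w = k - 1" "set_mset w \<subseteq> {..<r}" for w
    proof -
      have "\<exists>j<r. card V ^ k \<le> 2 * p ^ (k + 1) * cnt (add_mset j w)"
        unfolding cnt_def
      proof (rule dense_label_extension[OF H k2 Vne p0 less_imp_le[OF r(2)] _ _ _ _ w])
        show "card V \<le> p * card {x \<in> V. insert x S \<in> E}" if "S \<subseteq> V" "card S = k - 1" for S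
          using deg[OF that] assms(2) by (intro p_le[of \<gamma>]) auto
        show "card V \<le> p * card {u \<in> V. lab u = j}" if "j < r" for j
          using parts that assms(2) by (intro p_le[of "\<gamma> / 4"]) auto
        show "lab u < r" if "u \<in> V" for u using lab that by auto
        show "2 * p ^ k * (k * k) \<le> card V" using n cV by simp
      qed
      then obtain j where j: "j < r" "card V ^ k \<le> 2 * p ^ (k + 1) * cnt (add_mset j w)" by blast
      have "2 * p ^ (k + 1) * cnt (add_mset j w) \<le> N * cnt (add_mset j w)"
        by (rule mult_le_mono1) (simp add: N_def)
      then have "card V ^ k \<le> N * cnt (add_mset j w)" using j(2) by (rule order_trans[rotated])
      then have "add_mset j w \<in> R" using w j(1) r(2) k2 by (auto simp: R_def)
      then show ?thesis using j(1) good_base by blast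
    qed
    have "\<exists>t<p. \<forall>x. set_mset x \<subseteq> {..<r} \<longrightarrow> k dvd size x \<longrightarrow> good R (repeat_mset (1 + k * t) x)"
      by (rule good_multiple[OF assms(1) r p(3) ext])
    then obtain t where t: "t < p"
      and tgood: "\<And>x. set_mset x \<subseteq> {..<r} \<Longrightarrow> k dvd size x \<Longrightarrow> good R (repeat_mset (1 + k * t) x)" by blast
    have "\<exists>W\<subseteq>V. L * card W \<le> card V \<and> tileable E (mset_set W) \<and>
        (\<forall>D. D \<subseteq> V - W \<longrightarrow> card D \<le> C \<longrightarrow> reach V E (N2 + 1) (mset_set D) {#} \<longrightarrow>
           tileable E (mset_set (W \<union> D)))"
    proof (rule n2[THEN spec, THEN spec, THEN mp, THEN mp, OF fV])
      show "n2 \<le> card V" using n cV by simp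
    qed
    then obtain W where W: "W \<subseteq> V" "L * card W \<le> card V" "tileable E (mset_set W)"
      and absorb: "\<forall>D. D \<subseteq> V - W \<longrightarrow> card D \<le> C \<longrightarrow> reach V E (N2 + 1) (mset_set D) {#} \<longrightarrow>
           tileable E (mset_set (W \<union> D))" by (elim exE conjE)
    have fW: "finite W" using W(1) fV finite_subset by blast
    have cW: "card W \<le> \<gamma> / 8 * n"
    proof -
      have "8 / \<gamma> * card W \<le> L * real (card W)" using L by (intro mult_right_mono) auto
      also have "\<dots> \<le> n" using W(2) cV by (metis of_nat_mono of_nat_mult)
      finally show ?thesis using assms(2) by (simp add: field_simps)
    qed
    have Kk: "real (K * k) < \<gamma> / 8 * n" "real (p * (K * k)) < \<gamma> / 8 * n"
    proof -
      show *: "real (p * (K * k)) < \<gamma> / 8 * n" using large by simp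
      have "1 * (K * k) \<le> p * (K * k)" using p0 by (intro mult_le_mono1) simp
      then have "real (K * k) \<le> real (p * (K * k))" by (simp only: of_nat_le_iff mult_1)
      then show "real (K * k) < \<gamma> / 8 * n" using * by linarith
    qed
    \<comment> \<open>A part has at least \<open>(1 / p + \<gamma> / 4) * n\<close> vertices.
      Removing \<open>W\<close> and up to \<open>K * k\<close> vertices of earlier edges costs less
      than \<open>\<gamma> / 4 * n\<close>, so more than \<open>n / p\<close> vertices remain, too
      many for an independent set.\<close>
    have "\<exists>F\<subseteq>E. pairwise disjnt F \<and> finite F \<and> card F = K \<and> \<Union>F \<subseteq> {u \<in> V - W. lab u = j}"
      if j: "j < r" for j
    proof (rule disjoint_edges_exist[OF H])
      show "0 < k" using k2 by simp
      show "finite {u \<in> V - W. lab u = j}" using fV by simp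
      fix Y assume Y: "Y \<subseteq> {u \<in> V - W. lab u = j}" "card {u \<in> V - W. lab u = j} \<le> card Y + K * k"
      have "{u \<in> V. lab u = j} \<subseteq> {u \<in> V - W. lab u = j} \<union> W" by blast
      then have "card {u \<in> V. lab u = j} \<le> card ({u \<in> V - W. lab u = j} \<union> W)"
        using fV fW by (intro card_mono) auto
      also have "\<dots> \<le> card {u \<in> V - W. lab u = j} + card W" by (rule card_Un_le)
      finally have "real (card {u \<in> V. lab u = j}) \<le> real (card Y + K * k + card W)"
        using Y(2) by (intro of_nat_mono) linarith
      moreover have "(1 / p + \<gamma> / 4) * n \<le> card {u \<in> V. lab u = j}" using parts j cV by simp
      ultimately have "(1 / p + \<gamma> / 4) * n < card Y + \<gamma> / 8 * n + \<gamma> / 8 * n"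
        using Kk(1) cW by simp
      then have "real n / p < card Y" by (simp add: algebra_simps)
      moreover have "Y \<subseteq> V" using Y(1) by blast
      ultimately show "\<exists>e\<in>E. e \<subseteq> Y" using contains_edge_if_card_gt[OF fV \<alpha>] by blast
    qed
    then have "\<forall>j. \<exists>F. j < r \<longrightarrow> F \<subseteq> E \<and> pairwise disjnt F \<and> finite F \<and> card F = K \<and>
        \<Union>F \<subseteq> {u \<in> V - W. lab u = j}" by blast
    from choice[OF this] obtain F where "\<forall>j. j < r \<longrightarrow> F j \<subseteq> E \<and> pairwise disjnt (F j) \<and>
        finite (F j) \<and> card (F j) = K \<and> \<Union>(F j) \<subseteq> {u \<in> V - W. lab u = j}" ..
    then have F: "\<And>j. j < r \<Longrightarrow> F j \<subseteq> E" "\<And>j. j < r \<Longrightarrow> pairwise disjnt (F j)"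
      "\<And>j. j < r \<Longrightarrow> finite (F j)" "\<And>j. j < r \<Longrightarrow> card (F j) = K"
      "\<And>j. j < r \<Longrightarrow> \<Union>(F j) \<subseteq> {u \<in> V - W. lab u = j}" by simp_all
    define Z where "Z = (\<Union>j<r. \<Union>(F j))"
    have ZV: "Z \<subseteq> V" using F(5) unfolding Z_def by blast
    have fZ: "finite Z" using ZV fV finite_subset by blast
    have cZ: "card Z \<le> \<gamma> / 8 * n"
    proof -
      have "card (\<Union>(F j)) \<le> K * k" if j: "j < r" for j
      proof -
        have "card (\<Union>(F j)) \<le> (\<Sum>e\<in>F j. card e)" by (rule card_Union_le_sum_card)
        also have "\<dots> = (\<Sum>e\<in>F j. k)"
          using F(1)[OF j] uniform_hypergraph_edge(3)[OF H] by (intro sum.cong) auto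
        also have "\<dots> = K * k" using F(4)[OF j] by simp
        finally show ?thesis .
      qed
      then have "(\<Sum>j<r. card (\<Union>(F j))) \<le> (\<Sum>j<r. K * k)" by (intro sum_mono) simp
      moreover have "card Z \<le> (\<Sum>j<r. card (\<Union>(F j)))" unfolding Z_def by (intro card_UN_le) simp
      ultimately have "card Z \<le> r * (K * k)" by simp
      also have "\<dots> \<le> p * (K * k)" using r by (intro mult_le_mono1) simp
      finally have "real (card Z) \<le> real (p * (K * k))" by (rule of_nat_mono)
      then show ?thesis using Kk(2) by linarith
    qed
    \<comment> \<open>Deleting \<open>W\<close> and \<open>Z\<close> lowers degrees by at most
      \<open>\<gamma> / 4 * n\<close>, so they stay above \<open>n / p\<close>; since
      \<open>p \<le> k\<close> this exceeds \<open>n / k\<close>.\<close>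
    have "\<exists>M. M \<subseteq> E \<and> pairwise disjnt M \<and> \<Union>M \<subseteq> V - W - Z \<and> card (V - W - Z - \<Union>M) < k * (k - 1)"
    proof (rule almost_perfect_matching[OF H k2])
      show "V - W - Z \<subseteq> V" by blast
      fix S assume S: "S \<subseteq> V - W - Z" "card S = k - 1"
      let ?N = "{v \<in> V - W - Z. insert v S \<in> E}"
      have "{x \<in> V. insert x S \<in> E} \<subseteq> ?N \<union> (W \<union> Z)" by blast
      then have "card {x \<in> V. insert x S \<in> E} \<le> card (?N \<union> (W \<union> Z))"
        using fV fW fZ by (intro card_mono) auto
      also have "\<dots> \<le> card ?N + (card W + card Z)"
        using card_Un_le[of ?N "W \<union> Z"] card_Un_le[of W Z] by linarith
      finally have "real (card {x \<in> V. insert x S \<in> E}) \<le> real (card ?N + (card W + card Z))"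
        by (rule of_nat_mono)
      moreover have "(1 / p + \<gamma>) * n \<le> card {x \<in> V. insert x S \<in> E}"
        using deg[of S] S cV by auto
      ultimately have "(1 / p + \<gamma>) * n \<le> card ?N + \<gamma> / 8 * n + \<gamma> / 8 * n" using cW cZ by simp
      moreover have "0 < \<gamma> * n" using assms(2) n0 by simp
      ultimately have "real n / p < card ?N" by (simp add: algebra_simps)
      then have "real n < real (p * card ?N)" using p0 by (simp add: field_simps)
      then have "n < p * card ?N" by (simp only: of_nat_less_iff)
      also have "\<dots> \<le> k * card ?N" using p(2) by (rule mult_le_mono1)
      finally have "n < k * card ?N" .
      moreover have "card (V - W - Z) \<le> n" unfolding cV[symmetric] using fV by (intro card_mono) auto
      ultimately show "card (V - W - Z) < k * card ?N" by linarith
    qed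
    then obtain M where M: "M \<subseteq> E" "pairwise disjnt M" "\<Union>M \<subseteq> V - W - Z"
      "card (V - W - Z - \<Union>M) < k * (k - 1)" by (elim exE conjE)
    let ?U = "V - W - Z - \<Union>M"
    have tU: "t * card ?U \<le> K" unfolding K_def using t M(4) by (intro mult_le_mono) auto
    have CU: "(1 + k * t) * card ?U \<le> C"
      unfolding C_def using t M(4) by (intro mult_le_mono add_le_mono) auto
    have "tileable E (mset_set V)"
    proof (rule tileable_from_absorber[where F = F and M = M and U = ?U and K = K and t = t and R = R])
      show "tileable E (mset_set (W \<union> D))"
        if D: "D \<subseteq> V - W" "card D \<le> (1 + k * t) * card ?U" "good R (image_mset lab (mset_set D))" for D
      proof -
        have fD: "finite D" using D(1) fV by (meson finite_Diff finite_subset)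
        have DC: "card D \<le> C" using D(2) CU by linarith
        have "R \<subseteq> {x. set_mset x \<subseteq> {..<p} \<and> size x \<le> k}" by (auto simp: R_def)
        moreover have "set_mset (mset_set D) \<subseteq> V" using D(1) fD by auto
        moreover have "lab ` V \<subseteq> {..<p}" using lab r(2) by auto
        moreover have "size (mset_set D) \<le> C" using DC by simp
        ultimately have "reach V E N2 (mset_set D) {#}" using N2 labelled D(3) by blast
        then have "reach V E (N2 + 1) (mset_set D) {#}" by (rule reach_mono) simp
        then show ?thesis using absorb D(1) DC by blast
      qed
      show "k dvd card V" using kn cV by simp
      show "\<Union>M \<subseteq> V - W - (\<Union>j<r. \<Union>(F j))" using M(3) by (simp add: Z_def)
      show "?U = V - W - (\<Union>j<r. \<Union>(F j)) - \<Union>M" by (simp add: Z_def)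
    qed (use H k2 lab W F M tU tgood in \<open>simp_all\<close>)
    then show "\<exists>M. perfect_matching V E M"
      using fV uniform_hypergraph_edge[OF H] k2
      by (intro perfect_matching_if_tileable) fastforce+
  qed
qed

end
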